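(* Let $\dot A$ be the non-negative symmetric Schrödinger operator in $L_2[a,+\infty)$ with deficiency indices $(1,1)$ and $m_\infty(-0)<\infty$ described in the context, and let $\operatorname{Im}h>0$. Let $\Theta$ be an L-system whose state-space operator $\mathbb A=\mathbb A_\mu$ is a $( * )$-extension of an $\alpha$-sectorial Schrödinger operator $T_h$ with the exact angle of sectoriality $\alpha\in(0,\pi/2)$. Then the associated operator $\tilde{\mathbb A}=\tilde{\mathbb A}_\mu$ is accretive but not $\alpha'$-sectorial for any $\alpha'\in(0,\pi/2)$ if and only if $$\mu=\operatorname{Re}h .$$
   Context: **Schrödinger operators.** Let $\mathcal H=L_2[a,+\infty)$ and $l(y)=-y''+q(x)y$ with $q$ real and locally summable. Let $\dot A y=l(y)$ with boundary conditions $y(a)=y'(a)=0$ be the (closed, densely defined) minimal symmetric operator; it is assumed to have deficiency indices $(1,1)$ and to be non-negative. Then $\mathcal H_+=\operatorname{Dom}(\dot A^* )$ is the set of $y\in L_2[a,+\infty)$ such that $y,y'$ are locally absolutely continuous and $l(y)\in L_2[a,+\infty)$, with inner product $(y,z)_+=\int_a^\infty (y\bar z+l(y)\overline{l(z)})\,dx$. $\mathcal H_+\subset\mathcal H\subset\mathcal H_-$ is the corresponding rigged Hilbert space ($\mathcal H_-$ is the dual of $\mathcal H_+$ with respect to the pairing extending the inner product $(\cdot,\cdot)$ of $\mathcal H$). $[\mathcal H_+,\mathcal H_-]$ is the set of bounded linear operators from $\mathcal H_+$ to $\mathcal H_-$; the adjoint of $\mathbb A\in[\mathcal H_+,\mathcal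 H_-]$ is again in $[\mathcal H_+,\mathcal H_-]$. The functionals $\delta(x-a),\delta'(x-a)\in\mathcal H_-$ act by $(y,\delta(x-a))=y(a)$, $(y,\delta'(x-a))=-y'(a)$. For $h\in\mathbb C$ with $\operatorname{Im}h>0$, $T_h y=l(y)$ with domain $\{y\in\mathcal H_+: y'(a)=hy(a)\}$. **The function $m_\infty$.** Let $\varphi_1,\varphi_2$ solve $l(\varphi_k)=\lambda\varphi_k$ with $\varphi_1(a,\lambda)=0,\ \varphi_1'(a,\lambda)=1$, $\varphi_2(a,\lambda)=-1,\ \varphi_2'(a,\lambda)=0$. $m_\infty(\lambda)$ is the function for which $\varphi_2(x,\lambda)+m_\infty(\lambda)\varphi_1(x,\lambda)\in L_2[a,+\infty)$, and $m_\infty(-0)=\lim_{x\to-0}m_\infty(x)$. It is assumed that $m_\infty(-0)<\infty$. **$( * )$-extensions.** The $( * )$-extensions of $T_h$ are in one-to-one correspondence with the parameters $\mu\in[-\infty,+\infty]$ (with $\pm\infty$ identified); they are the operators $\mathbb A=\mathbb A_\mu\in[\mathcal H_+,\mathcal H_-]$, $$\mathbb A_\mu y=-y''+q(x)y-\frac{1}{\mu-h}\,[y'(a)-hy(a)]\,[\mu\,\delta(x-a)+\delta'(x-a)],$$ with $\mathbb A_{\infty}y=-y''+q(x)y+[hy(a)-y'(a)]\,\delta(x-a)$. $\operatorname{Re}\mathbb A=(\mathbb A+\mathbb A^* )/2$, $\operatorname{Im}\mathbb A=(\mathbb A-\mathbb A^* )/(2i)$. **L-system.** For such $\mathbb A=\mathbb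 A_\mu$ one has $\operatorname{Im}\mathbb A=KK^*$ with $K:\mathbb C\to\mathcal H_-$, $Kc=cg$, $g=\frac{(\operatorname{Im}h)^{1/2}}{|\mu-h|}[\mu\delta(x-a)+\delta'(x-a)]$. The L-system $\Theta$ is the array consisting of $\mathbb A$ (state-space operator), $K$ (channel operator) and the triplet $\mathcal H_+\subset\mathcal H\subset\mathcal H_-$ with input-output space $\mathbb C$; $T_h$ is its main operator. **Associated operator.** $\tilde{\mathbb A}=2\operatorname{Re}\dot A^*-\mathbb A\in[\mathcal H_+,\mathcal H_-]$, where $\dot A^*$ is regarded as an element of $[\mathcal H_+,\mathcal H_-]$. For $\mathbb A=\mathbb A_\mu$ this is $$\tilde{\mathbb A}_\mu y=-y''+q(x)y-y'(a)\delta(x-a)-y(a)\delta'(x-a)+\frac{1}{\mu-h}[y'(a)-hy(a)]\,[\mu\delta(x-a)+\delta'(x-a)].$$ **Accretivity and sectoriality.** An operator $T$ in $\mathcal H$ is $\alpha$-sectorial, $\alpha\in(0,\pi/2)$, if $(\cot\alpha)|\operatorname{Im}(Tf,f)|\le\operatorname{Re}(Tf,f)$ for all $f\in\operatorname{Dom}(T)$, and the angle $\alpha$ is exact if $\tan\alpha=\sup_{f\in\operatorname{Dom}(T)}|\operatorname{Im}(Tf,f)|/\operatorname{Re}(Tf,f)$. An operator $\mathbb B\in[\mathcal H_+,\mathcal H_-]$ is accretive if $\operatorname{Re}(\mathbb Bf,f)\ge0$ for all $f\in\mathcal H_+$, and $\alpha$-sectorial if $(\cot\alpha)|\operatorname{Im}(\mathbb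 Bf,f)|\le\operatorname{Re}(\mathbb Bf,f)$ for all $f\in\mathcal H_+$. *)

theory Defs
  imports "HOL-Analysis.Analysis"
begin

text \<open>
  Elements of \<open>L\<^sub>2[a,\<infinity>)\<close> are represented by functions on the real line of which only the
  values on \<open>{a..}\<close> matter; equality in \<open>L\<^sub>2\<close> is equality almost everywhere on \<open>{a..}\<close>.
\<close>

definition L2 :: "real \<Rightarrow> (real \<Rightarrow> complex) set" where
  "L2 a = {f. f \<in> borel_measurable (lebesgue_on {a..}) \<and>
              integrable (lebesgue_on {a..}) (\<lambda>x. (cmod (f x))\<^sup>2)}"

definition ip :: "real \<Rightarrow> (real \<Rightarrow> complex) \<Rightarrow> (real \<Rightarrow> complex) \<Rightarrow> complex" where
  "ip a f g = (LINT x|lebesgue_on {a..}. f x * cnj (g x))"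

definition norm_L2 :: "real \<Rightarrow> (real \<Rightarrow> complex) \<Rightarrow> real" where
  "norm_L2 a f = sqrt (Re (ip a f f))"

definition eq_ae :: "real \<Rightarrow> (real \<Rightarrow> complex) \<Rightarrow> (real \<Rightarrow> complex) \<Rightarrow> bool" where
  "eq_ae a f g \<longleftrightarrow> (AE x in lebesgue_on {a..}. f x = g x)"

definition locally_summable :: "real \<Rightarrow> (real \<Rightarrow> 'b::euclidean_space) \<Rightarrow> bool" where
  "locally_summable a f \<longleftrightarrow> (\<forall>b\<ge>a. f absolutely_integrable_on {a..b})"


subsection \<open>The differential expression\<close>

text \<open>
  A function is locally absolutely continuous on \<open>[a,\<infinity>)\<close> iff it is the indefinite Lebesgue
  integral of a locally summable function; this density is unique up to null sets and is the
  almost everywhere derivative.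
\<close>

definition ac_density :: "real \<Rightarrow> (real \<Rightarrow> complex) \<Rightarrow> (real \<Rightarrow> complex) \<Rightarrow> bool" where
  "ac_density a f g \<longleftrightarrow> locally_summable a g \<and> (\<forall>b\<ge>a. (g has_integral (f b - f a)) {a..b})"

definition locally_ac :: "real \<Rightarrow> (real \<Rightarrow> complex) \<Rightarrow> bool" where
  "locally_ac a f \<longleftrightarrow> (\<exists>g. ac_density a f g)"

text \<open>The pointwise derivative on \<open>[a,\<infinity>)\<close>, one-sided at \<open>a\<close>.\<close>

definition D1 :: "real \<Rightarrow> (real \<Rightarrow> complex) \<Rightarrow> real \<Rightarrow> complex" where
  "D1 a y x = vector_derivative y (at x within {a..})"

text \<open>The second derivative, a representative of a class modulo null sets.\<close>

definition D2 :: "real \<Rightarrow> (real \<Rightarrow> complex) \<Rightarrow> real \<Rightarrow> complex" where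
  "D2 a y = (SOME g. ac_density a (D1 a y) g)"

definition regular :: "real \<Rightarrow> (real \<Rightarrow> complex) \<Rightarrow> bool" where
  "regular a y \<longleftrightarrow> (\<forall>x\<ge>a. y differentiable (at x within {a..})) \<and>
                   locally_ac a y \<and> locally_ac a (D1 a y)"

definition lexpr :: "real \<Rightarrow> (real \<Rightarrow> real) \<Rightarrow> (real \<Rightarrow> complex) \<Rightarrow> real \<Rightarrow> complex" where
  "lexpr a q y x = - D2 a y x + of_real (q x) * y x"


subsection \<open>Unbounded operators, given by a domain and an action\<close>

definition densely_defined :: "real \<Rightarrow> (real \<Rightarrow> complex) set \<Rightarrow> bool" where
  "densely_defined a D \<longleftrightarrow>
     D \<subseteq> L2 a \<and> (\<forall>f\<in>L2 a. \<forall>e>0. \<exists>g\<in>D. norm_L2 a (\<lambda>x. f x - g x) < e)"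

definition closed_operator ::
  "real \<Rightarrow> (real \<Rightarrow> complex) set \<Rightarrow> ((real \<Rightarrow> complex) \<Rightarrow> real \<Rightarrow> complex) \<Rightarrow> bool" where
  "closed_operator a D T \<longleftrightarrow>
     (\<forall>y f g. (\<forall>n::nat. y n \<in> D) \<and> f \<in> L2 a \<and> g \<in> L2 a \<and>
        (\<lambda>n. norm_L2 a (\<lambda>x. y n x - f x)) \<longlonglongrightarrow> 0 \<and>
        (\<lambda>n. norm_L2 a (\<lambda>x. T (y n) x - g x)) \<longlonglongrightarrow> 0 \<longrightarrow>
        (\<exists>z\<in>D. eq_ae a z f \<and> eq_ae a (T z) g))"

definition symmetric_operator ::
  "real \<Rightarrow> (real \<Rightarrow> complex) set \<Rightarrow> ((real \<Rightarrow> complex) \<Rightarrow> real \<Rightarrow> complex) \<Rightarrow> bool" where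
  "symmetric_operator a D T \<longleftrightarrow> (\<forall>f\<in>D. \<forall>g\<in>D. ip a (T f) g = ip a f (T g))"

definition nonnegative_operator ::
  "real \<Rightarrow> (real \<Rightarrow> complex) set \<Rightarrow> ((real \<Rightarrow> complex) \<Rightarrow> real \<Rightarrow> complex) \<Rightarrow> bool" where
  "nonnegative_operator a D T \<longleftrightarrow> (\<forall>f\<in>D. ip a (T f) f \<in> \<real>\<^sub>\<ge>\<^sub>0)"

text \<open>The kernel of \<open>T\<^sup>* - z\<close>, where \<open>T\<^sup>*\<close> is the Hilbert space adjoint.\<close>

definition deficiency_space ::
  "real \<Rightarrow> (real \<Rightarrow> complex) set \<Rightarrow> ((real \<Rightarrow> complex) \<Rightarrow> real \<Rightarrow> complex) \<Rightarrow> complex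
     \<Rightarrow> (real \<Rightarrow> complex) set" where
  "deficiency_space a D T z = {y \<in> L2 a. \<forall>f\<in>D. ip a (T f) y = ip a f (\<lambda>x. z * y x)}"

definition one_dimensional :: "real \<Rightarrow> (real \<Rightarrow> complex) set \<Rightarrow> bool" where
  "one_dimensional a N \<longleftrightarrow>
     (\<exists>e\<in>N. \<not> eq_ae a e (\<lambda>_. 0) \<and> (\<forall>y\<in>N. \<exists>c. eq_ae a y (\<lambda>x. c * e x)))"

definition deficiency_indices_1_1 ::
  "real \<Rightarrow> (real \<Rightarrow> complex) set \<Rightarrow> ((real \<Rightarrow> complex) \<Rightarrow> real \<Rightarrow> complex) \<Rightarrow> bool" where
  "deficiency_indices_1_1 a D T \<longleftrightarrow>
     one_dimensional a (deficiency_space a D T \<i>) \<and>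
     one_dimensional a (deficiency_space a D T (- \<i>))"

definition sectorial ::
  "real \<Rightarrow> (real \<Rightarrow> complex) set \<Rightarrow> ((real \<Rightarrow> complex) \<Rightarrow> real \<Rightarrow> complex) \<Rightarrow> real \<Rightarrow> bool" where
  "sectorial a D T \<alpha> \<longleftrightarrow>
     (\<forall>f\<in>D. cot \<alpha> * \<bar>Im (ip a (T f) f)\<bar> \<le> Re (ip a (T f) f))"

text \<open>
  For a sectorial operator the quotients below are nonnegative and bounded above; where the
  denominator vanishes so does the numerator, and \<open>0 / 0 = 0\<close> does not affect the supremum.
\<close>

definition exact_angle ::
  "real \<Rightarrow> (real \<Rightarrow> complex) set \<Rightarrow> ((real \<Rightarrow> complex) \<Rightarrow> real \<Rightarrow> complex) \<Rightarrow> real \<Rightarrow> bool" where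
  "exact_angle a D T \<alpha> \<longleftrightarrow>
     tan \<alpha> = (SUP f\<in>D. \<bar>Im (ip a (T f) f)\<bar> / Re (ip a (T f) f))"


subsection \<open>The Schroedinger operators and the rigged Hilbert space\<close>

definition H_plus :: "real \<Rightarrow> (real \<Rightarrow> real) \<Rightarrow> (real \<Rightarrow> complex) set" where
  "H_plus a q = {y \<in> L2 a. regular a y \<and> lexpr a q y \<in> L2 a}"

definition ip_plus ::
  "real \<Rightarrow> (real \<Rightarrow> real) \<Rightarrow> (real \<Rightarrow> complex) \<Rightarrow> (real \<Rightarrow> complex) \<Rightarrow> complex" where
  "ip_plus a q y z =
     (LINT x|lebesgue_on {a..}. y x * cnj (z x) + lexpr a q y x * cnj (lexpr a q z x))"

definition norm_plus :: "real \<Rightarrow> (real \<Rightarrow> real) \<Rightarrow> (real \<Rightarrow> complex) \<Rightarrow> real" where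
  "norm_plus a q y = sqrt (Re (ip_plus a q y y))"

definition Dom_min :: "real \<Rightarrow> (real \<Rightarrow> real) \<Rightarrow> (real \<Rightarrow> complex) set" where
  "Dom_min a q = {y \<in> H_plus a q. y a = 0 \<and> D1 a y a = 0}"

definition Dom_T :: "real \<Rightarrow> (real \<Rightarrow> real) \<Rightarrow> complex \<Rightarrow> (real \<Rightarrow> complex) set" where
  "Dom_T a q h = {y \<in> H_plus a q. D1 a y a = h * y a}"

text \<open>
  An element \<open>\<psi>\<close> of \<open>H\<^sub>-\<close> is represented by the antilinear functional \<open>y \<mapsto> (\<psi>, y)\<close> on \<open>H\<^sub>+\<close>,
  so that \<open>(y, \<psi>)\<close> is \<open>cnj (\<psi> y)\<close>.
\<close>

type_synonym hminus = "(real \<Rightarrow> complex) \<Rightarrow> complex"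
type_synonym rigged_op = "(real \<Rightarrow> complex) \<Rightarrow> hminus"

definition H_minus :: "real \<Rightarrow> (real \<Rightarrow> real) \<Rightarrow> hminus set" where
  "H_minus a q = {\<psi>.
     (\<forall>y\<in>H_plus a q. \<forall>z\<in>H_plus a q. \<psi> (\<lambda>x. y x + z x) = \<psi> y + \<psi> z) \<and>
     (\<forall>c. \<forall>y\<in>H_plus a q. \<psi> (\<lambda>x. c * y x) = cnj c * \<psi> y) \<and>
     (\<exists>C. \<forall>y\<in>H_plus a q. cmod (\<psi> y) \<le> C * norm_plus a q y)}"

definition bounded_rigged :: "real \<Rightarrow> (real \<Rightarrow> real) \<Rightarrow> rigged_op set" where
  "bounded_rigged a q = {B.
     (\<forall>y\<in>H_plus a q. B y \<in> H_minus a q) \<and>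
     (\<forall>y\<in>H_plus a q. \<forall>z\<in>H_plus a q. \<forall>w\<in>H_plus a q. B (\<lambda>x. y x + z x) w = B y w + B z w) \<and>
     (\<forall>c. \<forall>y\<in>H_plus a q. \<forall>w\<in>H_plus a q. B (\<lambda>x. c * y x) w = c * B y w) \<and>
     (\<exists>C. \<forall>y\<in>H_plus a q. \<forall>w\<in>H_plus a q.
        cmod (B y w) \<le> C * norm_plus a q y * norm_plus a q w)}"

definition embed :: "real \<Rightarrow> (real \<Rightarrow> complex) \<Rightarrow> hminus" where
  "embed a f = (\<lambda>z. ip a f z)"

definition delta :: "real \<Rightarrow> hminus" where
  "delta a = (\<lambda>z. cnj (z a))"

definition delta' :: "real \<Rightarrow> hminus" where
  "delta' a = (\<lambda>z. - cnj (D1 a z a))"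

text \<open>The defining relation of the adjoint is \<open>(B y, z) = (y, B\<^sup>* z)\<close>.\<close>

definition adj_op :: "rigged_op \<Rightarrow> rigged_op" where
  "adj_op B = (\<lambda>y z. cnj (B z y))"

definition Re_op :: "rigged_op \<Rightarrow> rigged_op" where
  "Re_op B = (\<lambda>y z. (B y z + adj_op B y z) / 2)"

definition Im_op :: "rigged_op \<Rightarrow> rigged_op" where
  "Im_op B = (\<lambda>y z. (B y z - adj_op B y z) / (2 * \<i>))"

definition A_max :: "real \<Rightarrow> (real \<Rightarrow> real) \<Rightarrow> rigged_op" where
  "A_max a q = (\<lambda>y. embed a (lexpr a q y))"

definition A_mu :: "real \<Rightarrow> (real \<Rightarrow> real) \<Rightarrow> complex \<Rightarrow> ereal \<Rightarrow> rigged_op" where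
  "A_mu a q h \<mu> = (\<lambda>y z.
     if \<bar>\<mu>\<bar> = \<infinity> then
       embed a (lexpr a q y) z + (h * y a - D1 a y a) * delta a z
     else
       (let m = complex_of_real (real_of_ereal \<mu>) in
        embed a (lexpr a q y) z
          - 1 / (m - h) * (D1 a y a - h * y a) * (m * delta a z + delta' a z)))"

definition star_extension :: "real \<Rightarrow> (real \<Rightarrow> real) \<Rightarrow> complex \<Rightarrow> rigged_op \<Rightarrow> bool" where
  "star_extension a q h B \<longleftrightarrow> (\<exists>\<mu>. B = A_mu a q h \<mu>)"

definition associated_op :: "real \<Rightarrow> (real \<Rightarrow> real) \<Rightarrow> rigged_op \<Rightarrow> rigged_op" where
  "associated_op a q B = (\<lambda>y z. 2 * Re_op (A_max a q) y z - B y z)"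

definition accretive_rigged :: "real \<Rightarrow> (real \<Rightarrow> real) \<Rightarrow> rigged_op \<Rightarrow> bool" where
  "accretive_rigged a q B \<longleftrightarrow> (\<forall>f\<in>H_plus a q. Re (B f f) \<ge> 0)"

definition sectorial_rigged :: "real \<Rightarrow> (real \<Rightarrow> real) \<Rightarrow> rigged_op \<Rightarrow> real \<Rightarrow> bool" where
  "sectorial_rigged a q B \<alpha> \<longleftrightarrow> (\<forall>f\<in>H_plus a q. cot \<alpha> * \<bar>Im (B f f)\<bar> \<le> Re (B f f))"


subsection \<open>L-systems\<close>

text \<open>
  The rigged triplet is determined by \<open>a\<close> and \<open>q\<close>, and the input-output space is the complex
  plane, so the array is given by its state-space and channel operators.
\<close>

record L_system =
  state_op :: rigged_op
  channel_op :: "complex \<Rightarrow> hminus"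

text \<open>The adjoint \<open>H\<^sub>+ \<rightarrow> \<complex>\<close> of \<open>K\<close>, determined by \<open>(K c, y) = c * cnj (K\<^sup>* y)\<close>.\<close>

definition adj_channel :: "(complex \<Rightarrow> hminus) \<Rightarrow> (real \<Rightarrow> complex) \<Rightarrow> complex" where
  "adj_channel K y = cnj (K 1 y)"

definition is_L_system :: "real \<Rightarrow> (real \<Rightarrow> real) \<Rightarrow> complex \<Rightarrow> L_system \<Rightarrow> bool" where
  "is_L_system a q h \<Theta> \<longleftrightarrow>
     star_extension a q h (state_op \<Theta>) \<and>
     state_op \<Theta> \<in> bounded_rigged a q \<and>
     (\<exists>g\<in>H_minus a q. \<forall>c. \<forall>z\<in>H_plus a q. channel_op \<Theta> c z = c * g z) \<and>
     (\<forall>y\<in>H_plus a q. \<forall>z\<in>H_plus a q.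
        Im_op (state_op \<Theta>) y z = channel_op \<Theta> (adj_channel (channel_op \<Theta>) y) z)"


subsection \<open>The function \<open>m\<^sub>\<infinity>\<close>\<close>

definition solves :: "real \<Rightarrow> (real \<Rightarrow> real) \<Rightarrow> complex \<Rightarrow> (real \<Rightarrow> complex) \<Rightarrow> bool" where
  "solves a q z \<phi> \<longleftrightarrow> regular a \<phi> \<and> eq_ae a (lexpr a q \<phi>) (\<lambda>x. z * \<phi> x)"

definition m_infinity :: "real \<Rightarrow> (real \<Rightarrow> real) \<Rightarrow> complex \<Rightarrow> complex" where
  "m_infinity a q z = (THE m. \<exists>\<phi>1 \<phi>2.
     solves a q z \<phi>1 \<and> \<phi>1 a = 0 \<and> D1 a \<phi>1 a = 1 \<and>
     solves a q z \<phi>2 \<and> \<phi>2 a = -1 \<and> D1 a \<phi>2 a = 0 \<and>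
     (\<lambda>x. \<phi>2 x + m * \<phi>1 x) \<in> L2 a)"

definition m_infinity_finite_at_0_left :: "real \<Rightarrow> (real \<Rightarrow> real) \<Rightarrow> bool" where
  "m_infinity_finite_at_0_left a q \<longleftrightarrow>
     (\<exists>L::real. ((\<lambda>x. m_infinity a q (of_real x)) \<longlongrightarrow> of_real L) (at_left 0))"

end

theory Submission
  imports Defs
begin

text \<open>
  For \<open>y \<in> H\<^sub>+\<close> put \<open>u = y(a)\<close>, \<open>v = y'(a)\<close>, \<open>w = v - \<mu> u\<close> and \<open>Q(y) = Re (l(y), y) - Re (v cnj u)\<close>,
  formally the Dirichlet integral \<open>\<integral> |y'|\<^sup>2 + q |y|\<^sup>2\<close>. For finite \<open>\<mu>\<close> the associated operator satisfies
  \<open>Re (B y, y) = Q(y) + \<mu> |u|\<^sup>2 + (Re h - \<mu>) |w|\<^sup>2 / |\<mu> - h|\<^sup>2\<close> and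
  \<open>Im (B y, y) = - Im h |w|\<^sup>2 / |\<mu> - h|\<^sup>2\<close>.
  The boundary value \<open>v\<close> can be changed arbitrarily while \<open>u\<close> stays fixed and \<open>Q\<close> increases by
  arbitrarily little. Hence \<open>B\<close> is not accretive for \<open>\<mu> > Re h\<close> (take \<open>u = 0\<close>, \<open>v = 1\<close>) and for
  \<open>\<mu> = \<infinity>\<close>; for \<open>\<mu> < Re h\<close> accretivity gives \<open>Q(y) + \<mu> |u|\<^sup>2 \<ge> 0\<close>, so that \<open>B\<close> is sectorial with
  \<open>cot \<alpha>' = (Re h - \<mu>) / Im h\<close>; and for \<open>\<mu> = Re h\<close> the real part \<open>Q(y) + Re h |u|\<^sup>2\<close> is nonnegative
  because it agrees with \<open>Re (T\<^sub>h y, y)\<close> when \<open>v = h u\<close>, but it does not dominate any multiple of \<open>|w|\<^sup>2\<close>.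
\<close>

subsection \<open>Absolutely continuous functions\<close>

lemma locally_summable_subinterval:
  assumes "locally_summable a f" "a \<le> x"
  shows "f absolutely_integrable_on {x..y}"
proof -
  have "f absolutely_integrable_on {a..max a y}"
    using assms by (simp add: locally_summable_def)
  then show ?thesis
    by (rule absolutely_integrable_on_subinterval) (use assms in auto)
qed

lemma ac_density_has_integral:
  assumes "ac_density a f g" "a \<le> x" "x \<le> y"
  shows "(g has_integral (f y - f x)) {x..y}"
proof -
  have "g absolutely_integrable_on {x..y}"
    using assms by (auto simp: ac_density_def intro: locally_summable_subinterval)
  then have xy: "(g has_integral integral {x..y} g) {x..y}"
    using set_lebesgue_integral_eq_integral(1) by blast
  have "(g has_integral (f x - f a)) {a..x}" "(g has_integral (f y - f a)) {a..y}"
    using assms by (auto simp: ac_density_def)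
  with has_integral_combine[OF assms(2,3) _ xy] have "f y - f a = f x - f a + integral {x..y} g"
    by (meson has_integral_unique)
  then show ?thesis
    using xy by (simp add: algebra_simps)
qed

lemma ac_density_absolutely_integrable:
  "ac_density a f g \<Longrightarrow> a \<le> x \<Longrightarrow> g absolutely_integrable_on {x..y}"
  by (auto simp: ac_density_def intro: locally_summable_subinterval)

lemma continuous_on_atLeast_if_Icc:
  fixes f :: "real \<Rightarrow> 'a::topological_space"
  assumes "\<And>b. b \<ge> a \<Longrightarrow> continuous_on {a..b} f"
  shows "continuous_on {a..} f"
proof -
  have "continuous (at x within {a..}) f" if "x \<ge> a" for x
  proof -
    have "continuous (at x within {a..x+1}) f"
      using assms[of "x+1"] that by (auto simp: continuous_on_eq_continuous_within)
    moreover have "at x within {a..} = at x within {a..x+1}"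
      by (rule at_within_nhd[of _ "{..<x+1}"]) auto
    ultimately show ?thesis by simp
  qed
  then show ?thesis by (auto simp: continuous_on_eq_continuous_within)
qed

lemma ac_density_continuous:
  assumes "ac_density a f g"
  shows "continuous_on {a..} f"
proof (rule continuous_on_atLeast_if_Icc)
  fix b assume b: "a \<le> b"
  have "g integrable_on {a..b}"
    using ac_density_absolutely_integrable[OF assms order_refl]
      set_lebesgue_integral_eq_integral(1) by blast
  then have "continuous_on {a..b} (\<lambda>x. f a + integral {a..x} g)"
    by (intro continuous_intros indefinite_integral_continuous_1)
  moreover have "f a + integral {a..x} g = f x" if "x \<in> {a..b}" for x
    using integral_unique[OF ac_density_has_integral[OF assms order_refl, of x]] that by simp
  ultimately show "continuous_on {a..b} f"
    by (rule continuous_on_eq) 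
qed

lemma absolutely_integrable_continuous_mult:
  fixes f g :: "real \<Rightarrow> complex"
  assumes "continuous_on {x..y} f" "g absolutely_integrable_on {x..y}"
  shows "(\<lambda>t. f t * g t) absolutely_integrable_on {x..y}"
proof (rule absolutely_integrable_bounded_measurable_product[where h="(*)"])
  show "bilinear ((*) :: complex \<Rightarrow> complex \<Rightarrow> complex)"
    by (simp add: bilinear_conv_bounded_bilinear bounded_bilinear_mult)
  show "f \<in> borel_measurable (lebesgue_on {x..y})"
    using assms(1) by (simp add: continuous_imp_measurable_on_sets_lebesgue)
  show "bounded (f ` {x..y})"
    using assms(1) by (intro compact_imp_bounded compact_continuous_image) auto
qed (use assms in auto)

text \<open>
  On a short interval \<open>[u,v]\<close> the increment of \<open>f g\<close> differs from the integral of
  \<open>f' g + f g'\<close> by \<open>\<integral> f'(t) (g v - g t) + (f u - f t) g'(t) dt\<close>, which is at most \<open>\<epsilon>\<close> times the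
  additive interval function \<open>\<integral> |f'| + |g'|\<close>.
\<close>

lemma ac_density_mult:
  assumes f: "ac_density a f f'" and g: "ac_density a g g'"
  shows "ac_density a (\<lambda>x. f x * g x) (\<lambda>x. f' x * g x + f x * g' x)"
proof -
  define k where "k = (\<lambda>x. f' x * g x + f x * g' x)"
  define m where "m = (\<lambda>x. cmod (f' x) + cmod (g' x))"
  note cont = ac_density_continuous[OF f] ac_density_continuous[OF g]
  have cont': "continuous_on {x..y} f" "continuous_on {x..y} g" if "a \<le> x" for x y
    using that by (auto intro!: continuous_on_subset[OF cont(1)] continuous_on_subset[OF cont(2)])
  note ai = ac_density_absolutely_integrable[OF f] ac_density_absolutely_integrable[OF g]
  have k: "k absolutely_integrable_on {x..y}" if "a \<le> x" for x y
    unfolding k_def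
    using absolutely_integrable_continuous_mult[OF cont'(1)[OF that] ai(2)[OF that]]
      absolutely_integrable_continuous_mult[OF cont'(2)[OF that] ai(1)[OF that]]
    by (simp add: mult.commute set_integral_add(1))
  have m: "m integrable_on {x..y}" if "a \<le> x" for x y
    using ai[OF that, of y] unfolding m_def absolutely_integrable_on_def
    by (intro integrable_add) auto
  have m0: "m x \<ge> 0" for x by (simp add: m_def)
  have ki: "k integrable_on {x..y}" if "a \<le> x" for x y
    using k[OF that, of y] set_lebesgue_integral_eq_integral(1) by blast
  have main: "cmod (f b * g b - f a * g a - integral {a..b} k) \<le> e * integral {a..b} m"
    if b: "a \<le> b" and e: "e > 0" for b e
  proof -
    \<comment> \<open>Bisection tests every short interval around a point, including those that
      leave [a,b]; the guards make \<open>P\<close> hold trivially there. Both sides are additive up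
      to the triangle inequality, so \<open>P\<close> passes to adjacent unions.\<close>
    define P where "P = (\<lambda>x y. a \<le> x \<longrightarrow> y \<le> b \<longrightarrow>
      cmod (f y * g y - f x * g x - integral {x..y} k) \<le> e * integral {x..y} m)"
    have "P a b"
      using b
    proof (induction rule: Bolzano)
      case (trans x y z)
      show ?case
        unfolding P_def
      proof (intro impI)
        assume "a \<le> x" "z \<le> b"
        with trans have *: "a \<le> y" "y \<le> b" by auto
        have ik: "integral {x..z} k = integral {x..y} k + integral {y..z} k"
          and im: "integral {x..z} m = integral {x..y} m + integral {y..z} m"
          using trans(3,4) ki[OF \<open>a \<le> x\<close>] m[OF \<open>a \<le> x\<close>]
          by (simp_all add: Henstock_Kurzweil_Integration.integral_combine)
        have 1: "cmod (f y * g y - f x * g x - integral {x..y} k) \<le> e * integral {x..y} m"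
          and 2: "cmod (f z * g z - f y * g y - integral {y..z} k) \<le> e * integral {y..z} m"
          using trans(1,2) * \<open>a \<le> x\<close> \<open>z \<le> b\<close> by (auto simp: P_def)
        have "f z * g z - f x * g x - integral {x..z} k =
          (f y * g y - f x * g x - integral {x..y} k) + (f z * g z - f y * g y - integral {y..z} k)"
          by (simp add: ik)
        also have "cmod \<dots> \<le> e * integral {x..y} m + e * integral {y..z} m"
          by (rule norm_triangle_mono[OF 1 2])
        finally show "cmod (f z * g z - f x * g x - integral {x..z} k) \<le> e * integral {x..z} m"
          by (simp add: im distrib_left)
      qed
    next
      case (local x)
      have "\<exists>d>0. \<forall>t\<in>{a..}. dist t x < d \<longrightarrow> dist (f t) (f x) < e/2"
        "\<exists>d>0. \<forall>t\<in>{a..}. dist t x < d \<longrightarrow> dist (g t) (g x) < e/2"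
        using cont[unfolded continuous_on_iff, rule_format, of x "e/2"] local e by auto
      then obtain d1 d2 where d1: "d1 > 0" "\<And>t. t \<ge> a \<Longrightarrow> dist t x < d1 \<Longrightarrow> dist (f t) (f x) < e/2"
        and d2: "d2 > 0" "\<And>t. t \<ge> a \<Longrightarrow> dist t x < d2 \<Longrightarrow> dist (g t) (g x) < e/2"
        by (metis atLeast_iff)
      have "P u v" if uv: "u \<le> x" "x \<le> v" "v - u < min d1 d2" for u v
        unfolding P_def
      proof (intro impI)
        assume au: "a \<le> u" and vb: "v \<le> b"
        have osc: "cmod (f u - f t) \<le> e" "cmod (g v - g t) \<le> e" if "t \<in> {u..v}" for t
        proof -
          have "dist (f u) (f x) < e/2" "dist (f t) (f x) < e/2"
            "dist (g v) (g x) < e/2" "dist (g t) (g x) < e/2"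
            by (rule d1 d2; use uv that au in \<open>auto simp: dist_real_def\<close>)+
          then have "dist (f u) (f t) < e" "dist (g v) (g t) < e"
            by (auto intro: dist_triangle_half_l)
          then show "cmod (f u - f t) \<le> e" "cmod (g v - g t) \<le> e"
            by (simp_all add: dist_norm)
        qed
        \<comment> \<open>Freezing \<open>g\<close> at the right end and \<open>f\<close> at the
          left end gives an exact product rule: the two increments telescope to the increment of the
          product.\<close>
        have "((\<lambda>t. f' t * g v + f u * g' t - k t) has_integral
            ((f v - f u) * g v + f u * (g v - g u) - integral {u..v} k)) {u..v}"
          using uv au
          by (intro has_integral_diff has_integral_add has_integral_mult_left has_integral_mult_right
              ac_density_has_integral[OF f] ac_density_has_integral[OF g]
              integrable_integral[OF ki]) auto
        moreover have "(f v - f u) * g v + f u * (g v - g u) = f v * g v - f u * g u"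
          by (simp add: algebra_simps)
        ultimately have hi: "((\<lambda>t. f' t * g v + f u * g' t - k t) has_integral
            (f v * g v - f u * g u - integral {u..v} k)) {u..v}" by simp
        have "norm (integral {u..v} (\<lambda>t. f' t * g v + f u * g' t - k t))
          \<le> integral {u..v} (\<lambda>t. e * m t)"
        proof (rule integral_norm_bound_integral)
          show "(\<lambda>t. f' t * g v + f u * g' t - k t) integrable_on {u..v}"
            using hi by blast
          show "(\<lambda>t. e * m t) integrable_on {u..v}"
            by (rule integrable_on_mult_right[OF m[OF au]])
          fix t assume t: "t \<in> {u..v}"
          have "f' t * g v + f u * g' t - k t = f' t * (g v - g t) + (f u - f t) * g' t"
            by (simp add: k_def algebra_simps)
          also have "cmod \<dots> \<le> cmod (f' t) * e + e * cmod (g' t)"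
            using osc[OF t] by (intro norm_triangle_mono)
              (auto simp: norm_mult intro!: mult_left_mono mult_right_mono)
          finally show "norm (f' t * g v + f u * g' t - k t) \<le> e * m t"
            by (simp add: m_def algebra_simps)
        qed
        then show "cmod (f v * g v - f u * g u - integral {u..v} k) \<le> e * integral {u..v} m"
          using integral_unique[OF hi] by simp
      qed
      then show ?case
        using d1(1) d2(1) by (intro exI[of _ "min d1 d2"]) auto
    qed
    then show ?thesis by (simp add: P_def)
  qed
  have "f b * g b - f a * g a - integral {a..b} k = 0" if b: "a \<le> b" for b
  proof -
    let ?X = "f b * g b - f a * g a - integral {a..b} k" and ?M = "integral {a..b} m"
    have M: "?M \<ge> 0" using m0 by (intro integral_nonneg m) auto
    have "cmod ?X \<le> 0 + d" if "d > 0" for d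
    proof -
      \<comment> \<open>Dividing by \<open>?M + 1\<close> rather than \<open>?M\<close> also covers
        the case that the integral of \<open>m\<close> is zero.\<close>
      have "cmod ?X \<le> d / (?M + 1) * ?M"
        using M that by (intro main[OF b]) auto
      also have "\<dots> \<le> d" using M that by (auto simp: field_simps)
      finally show ?thesis by simp
    qed
    then have "cmod ?X \<le> 0" by (rule field_le_epsilon)
    then show ?thesis by simp
  qed
  then have "(k has_integral (f b * g b - f a * g a)) {a..b}" if "a \<le> b" for b
    using integrable_integral[OF ki[of a b]] that by simp
  then show ?thesis
    unfolding ac_density_def locally_summable_def k_def[symmetric]
    using k by auto
qed

section \<open>Closure properties of locally absolutely continuous functions\<close>

lemma ac_density_lincomb:
  assumes "ac_density a f f'" "ac_density a g g'"
  shows "ac_density a (\<lambda>x. f x + c * g x) (\<lambda>x. f' x + c * g' x)"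
  unfolding ac_density_def locally_summable_def
proof (intro conjI allI impI)
  fix b assume b: "a \<le> b"
  show "(\<lambda>x. f' x + c * g' x) absolutely_integrable_on {a..b}"
    using assms by (intro set_integral_add(1) set_integrable_mult_right)
      (auto intro: ac_density_absolutely_integrable)
  have "((\<lambda>x. f' x + c * g' x) has_integral (f b - f a) + c * (g b - g a)) {a..b}"
    using b assms by (intro has_integral_add has_integral_mult_right)
      (auto intro: ac_density_has_integral)
  then show "((\<lambda>x. f' x + c * g' x) has_integral f b + c * g b - (f a + c * g a)) {a..b}"
    by (simp add: algebra_simps)
qed

lemma ac_density_cnj:
  assumes "ac_density a f f'"
  shows "ac_density a (\<lambda>x. cnj (f x)) (\<lambda>x. cnj (f' x))"
  unfolding ac_density_def locally_summable_def
proof (intro conjI allI impI)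
  fix b assume b: "a \<le> b"
  show "(\<lambda>x. cnj (f' x)) absolutely_integrable_on {a..b}"
    using absolutely_integrable_linear[OF ac_density_absolutely_integrable[OF assms order_refl]
        bounded_linear_cnj] by (simp add: o_def)
  show "((\<lambda>x. cnj (f' x)) has_integral cnj (f b) - cnj (f a)) {a..b}"
    using has_integral_linear[OF ac_density_has_integral[OF assms order_refl b] bounded_linear_cnj]
    by (simp add: o_def)
qed

lemma ac_density_cong:
  assumes "ac_density a f g" "\<And>x. x \<ge> a \<Longrightarrow> f x = f1 x" "\<And>x. x \<ge> a \<Longrightarrow> g x = g1 x"
  shows "ac_density a f1 g1"
  unfolding ac_density_def locally_summable_def
proof (intro conjI allI impI)
  fix b assume b: "a \<le> b"
  show "g1 absolutely_integrable_on {a..b}"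
    using ac_density_absolutely_integrable[OF assms(1) order_refl, of b]
    by (rule absolutely_integrable_spike[where S="{}"]) (simp_all add: assms(3))
  show "(g1 has_integral f1 b - f1 a) {a..b}"
    using has_integral_eq[OF _ ac_density_has_integral[OF assms(1) order_refl b], of g1] assms b
    by simp
qed

section \<open>Pointwise derivatives on the half-line\<close>

lemma ac_density_has_vector_derivative:
  assumes "ac_density a f g" "continuous_on {a..} g" "x \<ge> a"
  shows "(f has_vector_derivative g x) (at x within {a..})"
proof -
  have "((\<lambda>u. integral {a..u} g) has_vector_derivative g x) (at x within {a..x+1})"
    using assms by (intro integral_has_vector_derivative) (auto intro: continuous_on_subset)
  then have "((\<lambda>u. f a + integral {a..u} g) has_vector_derivative g x) (at x within {a..x+1})"
    by (auto intro!: derivative_eq_intros)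
  then have "(f has_vector_derivative g x) (at x within {a..x+1})"
    by (rule has_vector_derivative_transform[rotated 2])
      (use assms integral_unique[OF ac_density_has_integral[OF assms(1) order_refl]] in auto)
  moreover have "at x within {a..} = at x within {a..x+1}"
    by (rule at_within_nhd[of _ "{..<x+1}"]) auto
  ultimately show ?thesis by simp
qed

lemma vector_derivative_atLeast:
  fixes f :: "real \<Rightarrow> 'a::real_normed_vector"
  assumes "(f has_vector_derivative d) (at x within {a..})" "x \<ge> a"
  shows "vector_derivative f (at x within {a..}) = d"
proof (rule vector_derivative_within[OF _ assms(1)])
  have "x islimpt {x..x+1}"
    by (simp add: islimpt_Icc)
  then have "x islimpt {a..}"
    by (rule islimpt_subset) (use assms(2) in auto)
  then show "at x within {a..} \<noteq> bot"
    by (simp add: trivial_limit_within)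
qed

lemma D1_eq:
  "(f has_vector_derivative d) (at x within {a..}) \<Longrightarrow> x \<ge> a \<Longrightarrow> D1 a f x = d"
  unfolding D1_def by (rule vector_derivative_atLeast)

text \<open>By Henstock's lemma the sum of |content * value - integral| over the cells of a fine
  division is small. Here every cell integral is zero, so this sum is the Riemann sum of the
  norm.\<close>

lemma has_integral_norm_0:
  fixes g :: "real \<Rightarrow> complex"
  assumes "\<And>x y. u \<le> x \<Longrightarrow> x \<le> y \<Longrightarrow> y \<le> v \<Longrightarrow> (g has_integral 0) {x..y}"
  shows "((\<lambda>x. norm (g x)) has_integral 0) {u..v}"
proof (cases "u \<le> v")
  case True
  have "((\<lambda>x. norm (g x)) has_integral 0) (cbox u v)"
    unfolding has_integral
  proof (intro allI impI)
    fix e :: real assume "e > 0"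
    have "g integrable_on cbox u v"
      using has_integral_integrable[OF assms[OF order_refl True order_refl]] by simp
    then obtain \<gamma> where "gauge \<gamma>"
      and \<gamma>: "\<And>p. p tagged_partial_division_of (cbox u v) \<Longrightarrow> \<gamma> fine p \<Longrightarrow>
             sum (\<lambda>(x,k). norm (measure lborel k *\<^sub>R g x - integral k g)) p < e"
      using \<open>e > 0\<close> by (rule Henstock_lemma) blast
    have "norm ((\<Sum>(x,k)\<in>p. measure lborel k *\<^sub>R norm (g x)) - 0) < e"
      if p: "p tagged_division_of cbox u v" "\<gamma> fine p" for p
    proof -
      have "(\<Sum>(x,k)\<in>p. measure lborel k *\<^sub>R norm (g x)) =
        (\<Sum>(x,k)\<in>p. norm (measure lborel k *\<^sub>R g x - integral k g))"
      proof (rule sum.cong, safe)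
        fix x k assume xk: "(x, k) \<in> p"
        obtain c d where k: "k = cbox c d" using tagged_division_ofD(4)[OF p(1) xk] by blast
        have "k \<subseteq> cbox u v" "x \<in> k" using tagged_division_ofD(2,3)[OF p(1) xk] by auto
        then have "integral k g = 0"
          using k assms[of c d] by (auto intro!: integral_unique)
        then show "measure lborel k *\<^sub>R norm (g x) = norm (measure lborel k *\<^sub>R g x - integral k g)"
          by simp
      qed
      also have "\<dots> < e"
        using p by (intro \<gamma>) (auto simp: tagged_division_of_def)
      finally have "(\<Sum>(x,k)\<in>p. measure lborel k *\<^sub>R norm (g x)) < e" .
      moreover have "(\<Sum>(x,k)\<in>p. measure lborel k *\<^sub>R norm (g x)) \<ge> 0"
        by (intro sum_nonneg) auto
      ultimately show ?thesis by simp
    qed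
    with \<open>gauge \<gamma>\<close> show "\<exists>\<gamma>. gauge \<gamma> \<and> (\<forall>\<D>. \<D> tagged_division_of cbox u v \<and> \<gamma> fine \<D> \<longrightarrow>
      norm ((\<Sum>(x,k)\<in>\<D>. measure lborel k *\<^sub>R norm (g x)) - 0) < e)"
      by (intro exI[of _ \<gamma>]) simp
  qed
  then show ?thesis by simp
qed simp

text \<open>The difference of two densities integrates to zero over every subinterval, hence so does
  its norm, and it vanishes almost everywhere. This makes the representative chosen in
  \<open>D2\<close> independent of the choice up to null sets.\<close>

lemma ac_density_unique:
  assumes "ac_density a f g" "ac_density a f h"
  shows "eq_ae a g h"
proof -
  define k where "k = (\<lambda>x. g x - h x)"
  have null: "AE x in lebesgue. x \<in> {a..a + real n} \<longrightarrow> k x = 0" for n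
  proof -
    let ?S = "{a..a + real n}"
    have "((\<lambda>x. norm (k x)) has_integral 0) ?S"
    proof (rule has_integral_norm_0)
      fix x y assume "a \<le> x" "x \<le> y"
      then show "(k has_integral 0) {x..y}"
        using has_integral_diff[OF ac_density_has_integral[OF assms(1)]
            ac_density_has_integral[OF assms(2)], of x y] by (simp add: k_def)
    qed
    moreover have "k absolutely_integrable_on ?S"
      unfolding k_def using assms
      by (intro set_integral_diff(1) ac_density_absolutely_integrable) auto
    then have int: "integrable (lebesgue_on ?S) (\<lambda>x. norm (k x))"
      using absolutely_integrable_measurable[of ?S k] by (simp add: o_def)
    ultimately have "(LINT x|lebesgue_on ?S. norm (k x)) = 0"
      using lebesgue_integral_eq_integral[OF int] by (simp add: integral_unique)
    then have "AE x in lebesgue_on ?S. norm (k x) = 0"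
      using integral_nonneg_eq_0_iff_AE[OF int] by simp
    then show ?thesis
      by (simp add: AE_restrict_space_iff)
  qed
  \<comment> \<open>Countably many bounded windows exhaust the half-line, so the exceptional null
    sets can be united.\<close>
  have "AE x in lebesgue. \<forall>n. x \<in> {a..a + real n} \<longrightarrow> k x = 0"
    using null by (subst AE_all_countable) blast
  then have "AE x in lebesgue. x \<in> {a..} \<longrightarrow> g x = h x"
  proof (rule AE_mp[OF _ AE_I2], intro impI)
    fix x assume *: "\<forall>n. x \<in> {a..a + real n} \<longrightarrow> k x = 0" and "x \<in> {a..}"
    obtain n where "x - a \<le> real n" using real_arch_simple by blast
    with \<open>x \<in> {a..}\<close> have "x \<in> {a..a + real n}" by auto
    with * have "k x = 0" by blast
    then show "g x = h x" by (simp add: k_def)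
  qed
  then show ?thesis
    by (simp add: eq_ae_def AE_restrict_space_iff)
qed

subsection \<open>The spaces \<open>L\<^sub>2\<close> and \<open>H\<^sub>+\<close>\<close>

text \<open>Extension by zero moves the question to the whole line, where completeness of Lebesgue
  measure allows changes on a null set.\<close>

lemma borel_measurable_eq_ae:
  assumes "f \<in> borel_measurable (lebesgue_on {a..})" "eq_ae a f g"
  shows "g \<in> borel_measurable (lebesgue_on {a..})"
proof -
  have "(\<lambda>x. if x \<in> {a..} then f x else 0) \<in> borel_measurable lebesgue"
    using borel_measurable_if[of "{a..}" f] assms(1) by simp
  moreover have "AE x in lebesgue. (if x \<in> {a..} then f x else 0) = (if x \<in> {a..} then g x else 0)"
    using assms(2) by (auto simp: eq_ae_def AE_restrict_space_iff)
  ultimately have "(\<lambda>x. if x \<in> {a..} then g x else 0) \<in> borel_measurable lebesgue"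
    by (rule borel_measurable_AE)
  then show ?thesis using borel_measurable_if[of "{a..}" g] by simp
qed

lemma L2_eq_ae:
  assumes "f \<in> L2 a" "eq_ae a f g"
  shows "g \<in> L2 a"
proof -
  have g: "g \<in> borel_measurable (lebesgue_on {a..})"
    using assms by (auto simp: L2_def intro: borel_measurable_eq_ae)
  have "integrable (lebesgue_on {a..}) (\<lambda>x. (cmod (f x))\<^sup>2)"
    using assms(1) by (simp add: L2_def)
  moreover have "(\<lambda>x. (cmod (g x))\<^sup>2) \<in> borel_measurable (lebesgue_on {a..})"
    using g by measurable
  moreover have "AE x in lebesgue_on {a..}. (cmod (f x))\<^sup>2 = (cmod (g x))\<^sup>2"
    using assms(2) unfolding eq_ae_def by (rule AE_mp) auto
  ultimately have "integrable (lebesgue_on {a..}) (\<lambda>x. (cmod (g x))\<^sup>2)"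
    by (rule integrable_cong_AE_imp)
  with g show ?thesis by (simp add: L2_def)
qed

section \<open>The inner product of square-integrable functions\<close>

lemma L2_mult_integrable:
  assumes "f \<in> L2 a" "g \<in> L2 a"
  shows "integrable (lebesgue_on {a..}) (\<lambda>x. f x * cnj (g x))"
proof (rule Bochner_Integration.integrable_bound)
  show "integrable (lebesgue_on {a..}) (\<lambda>x. (cmod (f x))\<^sup>2 + (cmod (g x))\<^sup>2)"
    using assms by (auto simp: L2_def)
  have "f \<in> borel_measurable (lebesgue_on {a..})" "g \<in> borel_measurable (lebesgue_on {a..})"
    using assms by (auto simp: L2_def)
  then show "(\<lambda>x. f x * cnj (g x)) \<in> borel_measurable (lebesgue_on {a..})"
    by (intro borel_measurable_times borel_measurable_continuous_on[of cnj] continuous_intros)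
  have "cmod (f x) * cmod (g x) \<le> (cmod (f x))\<^sup>2 + (cmod (g x))\<^sup>2" for x
    using sum_squares_bound[of "cmod (f x)" "cmod (g x)"]
      mult_nonneg_nonneg[of "cmod (f x)" "cmod (g x)"] norm_ge_zero[of "f x"] norm_ge_zero[of "g x"]
    by linarith
  then show "AE x in lebesgue_on {a..}. norm (f x * cnj (g x))
      \<le> norm ((cmod (f x))\<^sup>2 + (cmod (g x))\<^sup>2)"
    by (intro AE_I2) (simp add: norm_mult)
qed

lemma L2_lincomb:
  assumes "f \<in> L2 a" "g \<in> L2 a"
  shows "(\<lambda>x. f x + c * g x) \<in> L2 a"
proof -
  have meas: "(\<lambda>x. f x + c * g x) \<in> borel_measurable (lebesgue_on {a..})"
    using assms by (auto simp: L2_def)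
  have "integrable (lebesgue_on {a..}) (\<lambda>x. (cmod (f x + c * g x))\<^sup>2)"
  proof (rule Bochner_Integration.integrable_bound)
    show "integrable (lebesgue_on {a..})
        (\<lambda>x. 2 * (cmod (f x))\<^sup>2 + 2 * (cmod c)\<^sup>2 * (cmod (g x))\<^sup>2)"
      using assms by (auto simp: L2_def)
    show "(\<lambda>x. (cmod (f x + c * g x))\<^sup>2) \<in> borel_measurable (lebesgue_on {a..})"
      using meas by measurable
    have "(cmod (f x + c * g x))\<^sup>2 \<le> 2 * (cmod (f x))\<^sup>2 + 2 * (cmod c)\<^sup>2 * (cmod (g x))\<^sup>2" for x
    proof -
      have "(cmod (f x + c * g x))\<^sup>2 \<le> (cmod (f x) + cmod (c * g x))\<^sup>2"
        by (intro power_mono norm_triangle_ineq) auto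
      also have "\<dots> \<le> 2 * (cmod (f x))\<^sup>2 + 2 * (cmod (c * g x))\<^sup>2"
        using sum_squares_bound[of "cmod (f x)" "cmod (c * g x)"] by (simp add: power2_sum)
      finally show ?thesis by (simp add: norm_mult power_mult_distrib)
    qed
    then show "AE x in lebesgue_on {a..}. norm ((cmod (f x + c * g x))\<^sup>2)
        \<le> norm (2 * (cmod (f x))\<^sup>2 + 2 * (cmod c)\<^sup>2 * (cmod (g x))\<^sup>2)"
      by (intro AE_I2) simp
  qed
  with meas show ?thesis by (simp add: L2_def)
qed

lemma ip_lincomb_left:
  assumes "f \<in> L2 a" "g \<in> L2 a" "k \<in> L2 a"
  shows "ip a (\<lambda>x. f x + c * g x) k = ip a f k + c * ip a g k"
proof -
  have "(LINT x|lebesgue_on {a..}. f x * cnj (k x) + c * (g x * cnj (k x))) = ip a f k + c * ip a g k"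
    using assms by (simp add: ip_def L2_mult_integrable)
  then show ?thesis by (simp add: ip_def algebra_simps)
qed

lemma ip_commute: "ip a g f = cnj (ip a f g)"
  using Bochner_Integration.integral_cnj[of "lebesgue_on {a..}" "\<lambda>x. f x * cnj (g x)"]
  by (simp add: ip_def mult.commute)

lemma ip_lincomb_right:
  assumes "f \<in> L2 a" "g \<in> L2 a" "k \<in> L2 a"
  shows "ip a k (\<lambda>x. f x + c * g x) = ip a k f + cnj c * ip a k g"
  using ip_lincomb_left[OF assms, of c] ip_commute[of a k] by simp

lemma ip_cong_left:
  assumes "f \<in> L2 a" "g \<in> L2 a" "eq_ae a f f'"
  shows "ip a f' g = ip a f g"
  unfolding ip_def
proof (rule integral_cong_AE)
  show "(\<lambda>x. f' x * cnj (g x)) \<in> borel_measurable (lebesgue_on {a..})"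
    by (rule borel_measurable_integrable[OF L2_mult_integrable[OF L2_eq_ae[OF assms(1,3)] assms(2)]])
  show "(\<lambda>x. f x * cnj (g x)) \<in> borel_measurable (lebesgue_on {a..})"
    by (rule borel_measurable_integrable[OF L2_mult_integrable[OF assms(1,2)]])
  show "AE x in lebesgue_on {a..}. f' x * cnj (g x) = f x * cnj (g x)"
    using assms(3) unfolding eq_ae_def by (rule AE_mp) auto
qed

text \<open>The function \<open>y'\<close> is absolutely continuous, hence continuous, so it is the
  derivative of \<open>y\<close> at every point. The second derivative is fixed by its density only
  almost everywhere.\<close>

lemma regularI:
  assumes "ac_density a y y'" "ac_density a y' y''"
  shows "regular a y" "\<And>x. x \<ge> a \<Longrightarrow> D1 a y x = y' x" "eq_ae a (D2 a y) y''"
proof -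
  have der: "(y has_vector_derivative y' x) (at x within {a..})" if "x \<ge> a" for x
    using ac_density_has_vector_derivative[OF assms(1) ac_density_continuous[OF assms(2)] that] .
  then show D1: "D1 a y x = y' x" if "x \<ge> a" for x
    using D1_eq that by blast
  then have ac: "ac_density a (D1 a y) y''"
    by (intro ac_density_cong[OF assms(2)]) auto
  then show "regular a y"
    using der assms(1) by (auto simp: regular_def locally_ac_def has_vector_derivative_def
        differentiable_def)
  show "eq_ae a (D2 a y) y''"
    unfolding D2_def by (rule ac_density_unique[OF someI[of "ac_density a (D1 a y)", OF ac] ac])
qed

text \<open>Regularity provides some density of \<open>y\<close>, not a priori
  \<open>D1 a y\<close>. Since \<open>D1 a y\<close> is absolutely continuous and thus continuous,
  the fundamental theorem of calculus identifies it as a density.\<close>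

lemma regularD:
  assumes "regular a y"
  shows "ac_density a y (D1 a y)" "ac_density a (D1 a y) (D2 a y)"
proof -
  show D2: "ac_density a (D1 a y) (D2 a y)"
    using assms unfolding regular_def locally_ac_def D2_def using someI_ex[of "ac_density a (D1 a y)"] by blast
  note cont = ac_density_continuous[OF D2]
  have der: "(y has_vector_derivative D1 a y x) (at x within {a..})" if "x \<ge> a" for x
    using assms D1_eq[of y _ x a] that vector_derivative_works
    unfolding regular_def D1_def by blast
  show "ac_density a y (D1 a y)"
    unfolding ac_density_def locally_summable_def
  proof (intro conjI allI impI)
    fix b assume "a \<le> b"
    show "D1 a y absolutely_integrable_on {a..b}"
      by (intro absolutely_integrable_continuous_real continuous_on_subset[OF cont]) auto
    show "(D1 a y has_integral y b - y a) {a..b}"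
      using \<open>a \<le> b\<close>
      by (intro fundamental_theorem_of_calculus has_vector_derivative_within_subset[OF der]) auto
  qed
qed

lemma H_plusD:
  assumes "y \<in> H_plus a q"
  shows "y \<in> L2 a" "lexpr a q y \<in> L2 a"
    "ac_density a y (D1 a y)" "ac_density a (D1 a y) (D2 a y)"
  using assms regularD[of a y] by (auto simp: H_plus_def)

text \<open>Membership can be tested with explicit densities, without reference to the
  representative chosen in \<open>D2\<close>.\<close>

lemma H_plusI:
  assumes "ac_density a y y'" "ac_density a y' y''" "y \<in> L2 a"
    and L: "(\<lambda>x. - y'' x + of_real (q x) * y x) \<in> L2 a"
  shows "y \<in> H_plus a q" "\<And>x. x \<ge> a \<Longrightarrow> D1 a y x = y' x"
    "eq_ae a (\<lambda>x. - y'' x + of_real (q x) * y x) (lexpr a q y)"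
proof -
  note r = regularI[OF assms(1,2)]
  show "D1 a y x = y' x" if "x \<ge> a" for x using r(2) that by blast
  show ae: "eq_ae a (\<lambda>x. - y'' x + of_real (q x) * y x) (lexpr a q y)"
    using r(3) unfolding eq_ae_def lexpr_def by (rule AE_mp) auto
  show "y \<in> H_plus a q"
    unfolding H_plus_def using r(1) assms(3) L2_eq_ae[OF L ae] by simp
qed

lemma H_plus_lincomb:
  assumes y: "y \<in> H_plus a q" and z: "z \<in> H_plus a q"
  shows "(\<lambda>x. y x + c * z x) \<in> H_plus a q"
    and "\<And>x. x \<ge> a \<Longrightarrow> D1 a (\<lambda>x. y x + c * z x) x = D1 a y x + c * D1 a z x"
    and "eq_ae a (\<lambda>x. lexpr a q y x + c * lexpr a q z x) (lexpr a q (\<lambda>x. y x + c * z x))"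
proof -
  have eq: "- (D2 a y x + c * D2 a z x) + of_real (q x) * (y x + c * z x)
      = lexpr a q y x + c * lexpr a q z x" for x
    by (simp add: lexpr_def algebra_simps)
  have L: "(\<lambda>x. - (D2 a y x + c * D2 a z x) + of_real (q x) * (y x + c * z x)) \<in> L2 a"
    unfolding eq using y z by (intro L2_lincomb H_plusD)
  note I = H_plusI[OF ac_density_lincomb[OF H_plusD(3)[OF y] H_plusD(3)[OF z]]
      ac_density_lincomb[OF H_plusD(4)[OF y] H_plusD(4)[OF z]]
      L2_lincomb[OF H_plusD(1)[OF y] H_plusD(1)[OF z]] L]
  show "(\<lambda>x. y x + c * z x) \<in> H_plus a q" by (rule I)
  show "D1 a (\<lambda>x. y x + c * z x) x = D1 a y x + c * D1 a z x" if "x \<ge> a" for x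
    by (rule I(2)[OF that])
  show "eq_ae a (\<lambda>x. lexpr a q y x + c * lexpr a q z x) (lexpr a q (\<lambda>x. y x + c * z x))"
    using I(3) unfolding eq .
qed

lemma zero_H_plus: "(\<lambda>_. 0) \<in> H_plus a q" "D1 a (\<lambda>_. 0) a = 0"
proof -
  have "ac_density a (\<lambda>_. 0) (\<lambda>_. 0)"
    by (auto simp: ac_density_def locally_summable_def)
  moreover have "(\<lambda>_. 0) \<in> L2 a"
    by (simp add: L2_def)
  ultimately show "(\<lambda>_. 0) \<in> H_plus a q" "D1 a (\<lambda>_. 0) a = 0"
    using H_plusI[of a "\<lambda>_. 0" "\<lambda>_. 0" "\<lambda>_. 0" q] by auto
qed

text \<open>The Wronskian-type function \<open>W\<close> has density \<open>w\<close>, because the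
  first-order products cancel and the real potential drops out. The support condition on
  \<open>z\<close> removes the contribution at infinity, leaving only the one at a.\<close>

lemma green_formula:
  assumes y: "y \<in> H_plus a q" and z: "z \<in> H_plus a q"
    and supp: "\<And>x. x \<ge> b \<Longrightarrow> z x = 0 \<and> D1 a z x = 0"
  shows "ip a (lexpr a q z) y - ip a z (lexpr a q y) = D1 a z a * cnj (y a) - z a * cnj (D1 a y a)"
proof -
  define W where "W = (\<lambda>x. z x * cnj (D1 a y x) + (-1) * (D1 a z x * cnj (y x)))"
  define w where "w = (\<lambda>x. lexpr a q z x * cnj (y x) - z x * cnj (lexpr a q y x))"
  note Y = H_plusD[OF y] and Z = H_plusD[OF z]
  have W: "ac_density a W w"
    by (rule ac_density_cong[OF ac_density_lincomb[OF
          ac_density_mult[OF Z(3) ac_density_cnj[OF Y(4)]]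
          ac_density_mult[OF Z(4) ac_density_cnj[OF Y(3)]], where c = "-1"]])
      (auto simp: W_def w_def lexpr_def algebra_simps)
  have int: "integrable (lebesgue_on {a..}) w"
    unfolding w_def using Y Z by (intro Bochner_Integration.integrable_diff L2_mult_integrable)
  then have sint: "set_integrable lebesgue {a..} w"
    by (simp add: set_integrable_def integrable_restrict_space)
  have "((\<lambda>c. set_lebesgue_integral lebesgue {a..c} w) \<longlongrightarrow> set_lebesgue_integral lebesgue {a..} w) at_top"
    by (rule tendsto_set_lebesgue_integral_at_top[OF _ sint]) simp
  \<comment> \<open>Beyond the support of \<open>z\<close> the integrals over [a,c] no longer depend
    on c, so their limit is read off directly.\<close>
  moreover have "eventually (\<lambda>c. set_lebesgue_integral lebesgue {a..c} w = - W a) at_top"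
    using eventually_ge_at_top[of "max a b"]
  proof eventually_elim
    case (elim c)
    have "set_lebesgue_integral lebesgue {a..c} w = integral {a..c} w"
      by (rule set_lebesgue_integral_eq_integral(2))
        (rule ac_density_absolutely_integrable[OF W order_refl])
    also have "\<dots> = W c - W a"
      using elim by (intro integral_unique ac_density_has_integral[OF W]) auto
    also have "W c = 0"
      using supp[of c] elim by (simp add: W_def)
    finally show ?case by simp
  qed
  ultimately have "((\<lambda>c. - W a) \<longlongrightarrow> set_lebesgue_integral lebesgue {a..} w) (at_top :: real filter)"
    by (rule Lim_transform_eventually)
  then have "set_lebesgue_integral lebesgue {a..} w = - W a"
    by (simp add: tendsto_const_iff)
  moreover have "set_lebesgue_integral lebesgue {a..} w = (LINT x|lebesgue_on {a..}. w x)"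
    by (simp add: set_lebesgue_integral_def integral_restrict_space)
  moreover have "(LINT x|lebesgue_on {a..}. w x) = ip a (lexpr a q z) y - ip a z (lexpr a q y)"
    unfolding w_def ip_def using Y Z
    by (intro Bochner_Integration.integral_diff L2_mult_integrable)
  ultimately show ?thesis by (simp add: W_def)
qed

subsection \<open>Elements of \<open>H\<^sub>+\<close> supported near the end point\<close>

lemma locally_summable_imp_ac_density:
  assumes "locally_summable a g"
  shows "ac_density a (\<lambda>x. c + integral {a..x} g) g"
  unfolding ac_density_def
proof (intro conjI allI impI)
  fix b assume "a \<le> b"
  then have "g integrable_on {a..b}"
    using assms set_lebesgue_integral_eq_integral(1) unfolding locally_summable_def by blast
  then show "(g has_integral c + integral {a..b} g - (c + integral {a..a} g)) {a..b}"
    by (simp add: integrable_integral)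
qed (rule assms)

lemma locally_summable_continuous:
  fixes g :: "real \<Rightarrow> complex"
  shows "continuous_on {a..} g \<Longrightarrow> locally_summable a g"
  unfolding locally_summable_def
  by (auto intro!: absolutely_integrable_continuous_real elim: continuous_on_subset)

text \<open>
  Banach's fixed point theorem for the integral equation, with the potential truncated at
  \<open>a + \<delta>\<close> so that the solution becomes globally defined; only its values on \<open>[a, a + \<delta>]\<close>
  matter.
\<close>

lemma local_solution_exists:
  fixes q :: "real \<Rightarrow> real"
  assumes "locally_summable a q"
  obtains \<delta> where "\<delta> > 0" and "\<And>c0 c1. \<exists>Y V. Y a = c0 \<and> V a = c1 \<and> ac_density a Y V \<and>
    ac_density a V (\<lambda>x. if x \<le> a + \<delta> then of_real (q x) * Y x else 0)"
proof -
  define M where "M = integral {a..a+1} (\<lambda>x. \<bar>q x\<bar>)"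
  \<comment> \<open>This length makes the contraction constant \<delta> * M at most 1/2 and keeps
    the interval inside [a,a+1]. It is chosen before the initial data, so one \<delta> serves all of
    them.\<close>
  define \<delta> where "\<delta> = 1 / (2 * (M + 1))"
  have q1: "q absolutely_integrable_on {a..a+1}"
    using assms by (simp add: locally_summable_def)
  then have qabs: "(\<lambda>x. \<bar>q x\<bar>) integrable_on {a..a+1}"
    by (simp add: absolutely_integrable_on_def)
  have M: "M \<ge> 0"
    unfolding M_def by (intro integral_nonneg qabs) simp
  have \<delta>: "\<delta> > 0" "\<delta> \<le> 1" "\<delta> * M \<le> 1/2"
    using M by (auto simp: \<delta>_def field_simps)
  define Q where "Q = (\<lambda>x. if x \<le> a + \<delta> then complex_of_real (q x) else 0)"
  have Qint: "Q absolutely_integrable_on {a..b}" for b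
  proof -
    have "(\<lambda>x. complex_of_real (q x)) absolutely_integrable_on {a..a+\<delta>}"
      using absolutely_integrable_linear[OF locally_summable_subinterval[OF assms order_refl]
          bounded_linear_of_real] by (simp add: o_def)
    then have "(\<lambda>x. if x \<in> {a..a+\<delta>} then complex_of_real (q x) else 0) absolutely_integrable_on UNIV"
      by (subst absolutely_integrable_restrict_UNIV)
    then have "(\<lambda>x. if x \<in> {a..a+\<delta>} then complex_of_real (q x) else 0) absolutely_integrable_on {a..b}"
      by (rule set_integrable_subset) auto
    then show ?thesis
      by (rule absolutely_integrable_spike[where S="{}"]) (auto simp: Q_def)
  qed
  show thesis
  proof (rule that[OF \<delta>(1)])
    fix c0 c1 :: complex
    define VV where "VV = (\<lambda>y x. c1 + integral {a..x} (\<lambda>s. Q s * y s))"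
    define YY where "YY = (\<lambda>y x. c0 + integral {a..x} (VV y))"
    \<comment> \<open>Clamping the argument to [a,a+\<delta>] makes each iterate bounded and
      continuous on the whole line, so the map acts on the complete space of bounded continuous
      functions.\<close>
    define cl where "cl = (\<lambda>x. max a (min x (a + \<delta>)))"
    have cl: "cl x \<in> {a..a+\<delta>}" for x using \<delta> by (auto simp: cl_def)
    have Qy: "(\<lambda>s. Q s * y s) absolutely_integrable_on {a..b}" if "continuous_on UNIV y" for y b
      using absolutely_integrable_continuous_mult[OF continuous_on_subset[OF that] Qint]
      by (simp add: mult.commute)
    have V: "ac_density a (VV y) (\<lambda>s. Q s * y s)" if "continuous_on UNIV y" for y
      unfolding VV_def
      by (rule locally_summable_imp_ac_density) (simp add: locally_summable_def Qy that)
    have Y: "ac_density a (YY y) (VV y)" if "continuous_on UNIV y" for y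
      unfolding YY_def
      by (intro locally_summable_imp_ac_density locally_summable_continuous
          ac_density_continuous[OF V] that)
    define F where "F = (\<lambda>y :: real \<Rightarrow>\<^sub>C complex. Bcontfun (\<lambda>x. YY (apply_bcontfun y) (cl x)))"
    have contF: "continuous_on UNIV (\<lambda>x. YY (apply_bcontfun y) (cl x))" for y
    proof (rule continuous_on_compose2[OF ac_density_continuous[OF Y]])
      show "continuous_on UNIV cl" unfolding cl_def by (intro continuous_intros)
    qed (use cl in auto)
    have F: "apply_bcontfun (F y) x = YY (apply_bcontfun y) (cl x)" for y x
    proof -
      have "bounded (YY (apply_bcontfun y) ` {a..a+\<delta>})"
        by (intro compact_imp_bounded compact_continuous_image
            continuous_on_subset[OF ac_density_continuous[OF Y]]) auto
      then have "bounded (range (\<lambda>x. YY (apply_bcontfun y) (cl x)))"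
        by (rule bounded_subset) (use cl in auto)
      with contF[of y] have "(\<lambda>x. YY (apply_bcontfun y) (cl x)) \<in> bcontfun"
        by (simp add: bcontfun_def)
      then show ?thesis by (simp add: F_def Bcontfun_inverse)
    qed
    have "dist (F y) (F z) \<le> 1/2 * dist y z" for y z
    proof (rule dist_bound)
      fix x
      let ?D = "dist y z"
      have in_bd: "cmod (VV (apply_bcontfun y) s - VV (apply_bcontfun z) s) \<le> M * ?D"
        if s: "s \<in> {a..a+\<delta>}" for s
      proof -
        have qs: "(\<lambda>t. \<bar>q t\<bar>) integrable_on {a..s}"
          using s \<delta>(2) by (intro integrable_on_subinterval[OF qabs]) auto
        have i: "(\<lambda>t. Q t * apply_bcontfun w t) integrable_on {a..s}" for w
          using set_lebesgue_integral_eq_integral(1)[OF Qy] by simp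
        have "VV (apply_bcontfun y) s - VV (apply_bcontfun z) s =
            integral {a..s} (\<lambda>t. Q t * apply_bcontfun y t - Q t * apply_bcontfun z t)"
          unfolding VV_def by (simp add: Henstock_Kurzweil_Integration.integral_diff[OF i i])
        also have "cmod \<dots> \<le> integral {a..s} (\<lambda>t. \<bar>q t\<bar> * ?D)"
        proof (rule integral_norm_bound_integral)
          fix t
          have "cmod (Q t * apply_bcontfun y t - Q t * apply_bcontfun z t)
            = cmod (Q t) * dist (apply_bcontfun y t) (apply_bcontfun z t)"
            by (simp add: dist_norm norm_mult flip: right_diff_distrib)
          also have "\<dots> \<le> \<bar>q t\<bar> * ?D"
            by (intro mult_mono dist_bounded) (auto simp: Q_def)
          finally show "cmod (Q t * apply_bcontfun y t - Q t * apply_bcontfun z t) \<le> \<bar>q t\<bar> * ?D" .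
        qed (use i qs in \<open>auto intro!: integrable_diff integrable_on_mult_left\<close>)
        also have "\<dots> = integral {a..s} (\<lambda>t. \<bar>q t\<bar>) * ?D"
          by simp
        also have "\<dots> \<le> M * ?D"
          unfolding M_def using s \<delta>(2)
          by (intro mult_right_mono integral_subset_le qs qabs) auto
        finally show ?thesis .
      qed
      have i: "VV (apply_bcontfun w) integrable_on {a..cl x}" for w
        using set_lebesgue_integral_eq_integral(1)[OF ac_density_absolutely_integrable[OF Y order_refl]]
        by simp
      have "YY (apply_bcontfun y) (cl x) - YY (apply_bcontfun z) (cl x) =
          integral {a..cl x} (\<lambda>s. VV (apply_bcontfun y) s - VV (apply_bcontfun z) s)"
        unfolding YY_def by (simp add: Henstock_Kurzweil_Integration.integral_diff[OF i i])
      also have "cmod \<dots> \<le> integral {a..cl x} (\<lambda>s. M * ?D)"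
        using cl[of x] by (intro integral_norm_bound_integral integrable_diff i in_bd) auto
      also have "\<dots> = (cl x - a) * (M * ?D)"
        using cl[of x] by simp
      also have "\<dots> \<le> \<delta> * (M * ?D)"
        using cl[of x] M by (intro mult_right_mono) auto
      also have "\<dots> \<le> 1/2 * ?D"
        using mult_right_mono[OF \<delta>(3) zero_le_dist[of y z]] by (simp add: mult.assoc)
      finally show "dist (apply_bcontfun (F y) x) (apply_bcontfun (F z) x) \<le> 1/2 * ?D"
        by (simp add: F dist_norm)
    qed
    then obtain y where y: "F y = y"
      using banach_fix_type[of "1/2" F] by auto
    let ?Y = "YY (apply_bcontfun y)" and ?V = "VV (apply_bcontfun y)"
    \<comment> \<open>The solution is \<open>?Y\<close>, not the clamped fixed point
      \<open>y\<close>. The two agree on [a,a+\<delta>], and beyond it the truncated potential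
      \<open>Q\<close> is zero.\<close>
    have eq: "Q x * apply_bcontfun y x = (if x \<le> a + \<delta> then of_real (q x) * ?Y x else 0)"
      if "x \<ge> a" for x
    proof (cases "x \<le> a + \<delta>")
      case True
      then have "cl x = x" using that by (simp add: cl_def)
      then have "apply_bcontfun y x = ?Y x" using F[of y x] y by simp
      then show ?thesis using True by (simp add: Q_def)
    qed (simp add: Q_def)
    have "ac_density a ?V (\<lambda>x. if x \<le> a + \<delta> then of_real (q x) * ?Y x else 0)"
    proof (rule ac_density_cong[OF V])
      show "continuous_on UNIV (apply_bcontfun y)" by simp
    qed (rule refl, rule eq)
    moreover have "?Y a = c0" "?V a = c1"
      by (simp_all add: YY_def VV_def)
    ultimately show "\<exists>Y V. Y a = c0 \<and> V a = c1 \<and> ac_density a Y V \<and>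
      ac_density a V (\<lambda>x. if x \<le> a + \<delta> then of_real (q x) * Y x else 0)"
      using Y[of "apply_bcontfun y"] by (intro exI[of _ ?Y] exI[of _ ?V]) auto
  qed
qed

text \<open>The ramp falls linearly from 1 at a to 0 at a + \<epsilon>. Its derivative jumps, so it
  is the square of the ramp that serves below as a cut-off.\<close>

lemma ac_density_ramp:
  fixes \<epsilon> :: real
  assumes "\<epsilon> > 0"
  shows "ac_density a (\<lambda>x. complex_of_real (max 0 (1 - (x - a) / \<epsilon>)))
    (\<lambda>x. if x \<le> a + \<epsilon> then - 1 / of_real \<epsilon> else 0)" (is "ac_density a ?r ?r'")
proof -
  have ai: "?r' absolutely_integrable_on {a..b}" for b
  proof (rule measurable_bounded_by_integrable_imp_absolutely_integrable)
    show "?r' \<in> borel_measurable (lebesgue_on {a..b})"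
      by (intro measurable_restrict_space1 measurable_completion) measurable
    show "(\<lambda>_. 1 / \<epsilon>) integrable_on {a..b}" by (rule integrable_const_ivl)
    show "norm (?r' x) \<le> 1 / \<epsilon>" for x using assms by (auto simp: norm_divide)
  qed simp
  have "(?r' has_integral ?r b - ?r a) {a..b}" if "a \<le> b" for b
  proof -
    let ?c = "min b (a + \<epsilon>)"
    have "((\<lambda>_. - 1 / complex_of_real \<epsilon>) has_integral (?c - a) *\<^sub>R (- 1 / of_real \<epsilon>)) {a..?c}"
      using has_integral_const_real[of "- 1 / complex_of_real \<epsilon>" a ?c] that assms by simp
    then have "((\<lambda>x. if x \<in> {a..?c} then - 1 / complex_of_real \<epsilon> else 0) has_integral
        (?c - a) *\<^sub>R (- 1 / of_real \<epsilon>)) {a..b}"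
      by (subst has_integral_restrict) auto
    then have "(?r' has_integral (?c - a) *\<^sub>R (- 1 / of_real \<epsilon>)) {a..b}"
      by (rule has_integral_eq[rotated]) auto
    moreover have "max 0 (1 - (b - a) / \<epsilon>) - 1 = - (?c - a) / \<epsilon>"
      using assms by (auto simp: max_def min_def field_simps)
    then have "complex_of_real (max 0 (1 - (b - a) / \<epsilon>) - 1) = complex_of_real (- (?c - a) / \<epsilon>)"
      by (rule arg_cong)
    then have "?r b - ?r a = (?c - a) *\<^sub>R (- 1 / of_real \<epsilon>)"
      by (simp add: scaleR_conv_of_real diff_divide_distrib)
    ultimately show ?thesis by simp
  qed
  with ai show ?thesis by (simp add: ac_density_def locally_summable_def)
qed

section \<open>Estimates for functions supported in a bounded interval\<close>

lemma integrable_indicator_Icc: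
  "integrable (lebesgue_on {a..}) (indicator {a..b} :: real \<Rightarrow> real)"
  by (subst integrable_restrict_space)
    (auto simp: integrable_indicator_iff emeasure_lborel_Icc_eq simp flip: indicator_inter_arith)

lemma L2_bounded_support:
  assumes "f \<in> borel_measurable (lebesgue_on {a..})"
    and "\<And>x. x \<ge> a \<Longrightarrow> cmod (f x) \<le> B * indicator {a..b} x"
  shows "f \<in> L2 a"
proof -
  have "integrable (lebesgue_on {a..}) (\<lambda>x. (cmod (f x))\<^sup>2)"
  proof (rule Bochner_Integration.integrable_bound)
    show "integrable (lebesgue_on {a..}) (\<lambda>x. B\<^sup>2 * indicator {a..b} x :: real)"
      by (intro integrable_mult_right integrable_indicator_Icc)
    show "(\<lambda>x. (cmod (f x))\<^sup>2) \<in> borel_measurable (lebesgue_on {a..})"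
      using assms(1) by measurable
    have "(cmod (f x))\<^sup>2 \<le> B\<^sup>2 * indicator {a..b} x" if "x \<ge> a" for x
      using power_mono[OF assms(2)[OF that], of 2] by (auto simp: indicator_def split: if_splits)
    then show "AE x in lebesgue_on {a..}. norm ((cmod (f x))\<^sup>2) \<le> norm (B\<^sup>2 * indicator {a..b} x :: real)"
      by (intro AE_I2) auto
  qed
  with assms(1) show ?thesis by (simp add: L2_def)
qed

text \<open>One majorant covers two situations: with \<open>K = 0\<close> both factors are bounded
  on a short interval, and with \<open>s = g\<close> one factor is merely square-integrable.\<close>

lemma norm_ip_le:
  assumes f: "f \<in> L2 a" and g: "g \<in> L2 a" and s: "s \<in> L2 a" and "a \<le> b"
    and le: "\<And>x. x \<ge> a \<Longrightarrow> cmod (f x) * cmod (g x) \<le> K * (cmod (s x))\<^sup>2 + J * indicator {a..b} x"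
  shows "cmod (ip a f g) \<le> K * (LINT x|lebesgue_on {a..}. (cmod (s x))\<^sup>2) + J * (b - a)"
proof -
  note ind = integrable_indicator_Icc[of a b]
  have sint: "integrable (lebesgue_on {a..}) (\<lambda>x. (cmod (s x))\<^sup>2)"
    using s by (simp add: L2_def)
  have "cmod (ip a f g) \<le> (LINT x|lebesgue_on {a..}. cmod (f x * cnj (g x)))"
    unfolding ip_def by (rule integral_norm_bound)
  also have "\<dots> \<le> (LINT x|lebesgue_on {a..}. K * (cmod (s x))\<^sup>2 + J * indicator {a..b} x)"
    using integrable_norm[OF L2_mult_integrable[OF f g]] ind sint le
    by (intro integral_mono) (auto simp: norm_mult)
  also have "\<dots> = K * (LINT x|lebesgue_on {a..}. (cmod (s x))\<^sup>2)
      + J * (LINT x|lebesgue_on {a..}. indicator {a..b} x)"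
    using ind sint by simp
  also have "(LINT x|lebesgue_on {a..}. indicator {a..b} x) = b - a"
    using \<open>a \<le> b\<close> by (simp add: integral_restrict_space measure_restrict_space)
  finally show ?thesis .
qed

text \<open>The function is \<open>Y\<close> times the squared ramp, which has a double zero at a +
  \<epsilon>. Since \<open>V' = q Y\<close> near a, the potential cancels from the differential
  expression: only derivatives of the cut-off survive in \<open>H\<close>, so no bound on
  \<open>q\<close> is required.\<close>

lemma cutoff_in_H_plus:
  assumes Y: "ac_density a Y V"
    and V: "ac_density a V (\<lambda>x. if x \<le> a + \<delta> then of_real (q x) * Y x else 0)"
    and \<epsilon>: "0 < \<epsilon>" "\<epsilon> \<le> \<delta>"
    and bY: "\<And>x. x \<in> {a..a+\<epsilon>} \<Longrightarrow> cmod (Y x) \<le> A"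
    and bV: "\<And>x. x \<in> {a..a+\<epsilon>} \<Longrightarrow> cmod (V x) \<le> B"
  obtains f H where "f \<in> H_plus a q" "f a = Y a" "D1 a f a = V a - 2 / of_real \<epsilon> * Y a"
    "\<And>x. x \<ge> a + \<epsilon> \<Longrightarrow> f x = 0 \<and> D1 a f x = 0"
    "\<And>x. x \<ge> a \<Longrightarrow> cmod (f x) \<le> A * indicator {a..a+\<epsilon>} x"
    "H \<in> L2 a" "eq_ae a H (lexpr a q f)"
    "\<And>x. x \<ge> a \<Longrightarrow> cmod (H x) \<le> (2 / \<epsilon>\<^sup>2 * A + 4 / \<epsilon> * B) * indicator {a..a+\<epsilon>} x"
proof -
  define r where "r = (\<lambda>x. complex_of_real (max 0 (1 - (x - a) / \<epsilon>)))"
  define r' where "r' = (\<lambda>x. if x \<le> a + \<epsilon> then - 1 / complex_of_real \<epsilon> else 0)"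
  define c where "c = - 2 / complex_of_real \<epsilon>"
  have r: "ac_density a r r'"
    unfolding r_def r'_def by (rule ac_density_ramp[OF \<epsilon>(1)])
  have r0: "r x = 0" if "x \<ge> a + \<epsilon>" for x
    using that \<epsilon> by (auto simp: r_def max_def field_simps)
  have r'0: "r' x = 0" if "x > a + \<epsilon>" for x
    using that by (simp add: r'_def)
  \<comment> \<open>Although \<open>r'\<close> jumps at a + \<epsilon>, \<open>r\<close> vanishes
    from there on, so the derivative of the square is a constant multiple of the ramp and is itself
    absolutely continuous.\<close>
  have rr': "r x * r' x = c / 2 * r x" for x
    using r0[of x] by (auto simp: r'_def c_def)
  have r1: "cmod (r x) \<le> 1" if "x \<ge> a" for x
    using that \<epsilon> by (auto simp: r_def field_simps)
  have sq: "ac_density a (\<lambda>x. r x * r x) (\<lambda>x. c * r x)"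
    by (rule ac_density_cong[OF ac_density_mult[OF r r]]) (simp_all add: rr' mult.commute[of "r' x" "r x" for x])
  have zero: "ac_density a (\<lambda>_. 0) (\<lambda>_. 0)"
    by (auto simp: ac_density_def locally_summable_def)
  have cr: "ac_density a (\<lambda>x. c * r x) (\<lambda>x. c * r' x)"
    using ac_density_lincomb[OF zero r, of c] by simp
  define f where "f = (\<lambda>x. r x * r x * Y x)"
  define f' where "f' = (\<lambda>x. 1 * (c * r x * Y x) + 1 * (r x * r x * V x))"
  define f'' where "f'' = (\<lambda>x. (c * r' x * Y x + c * r x * V x) + 1 * (c * r x * V x
      + r x * r x * (if x \<le> a + \<delta> then of_real (q x) * Y x else 0)))"
  define H where "H = (\<lambda>x. - (c * r' x * Y x + 2 * c * r x * V x))"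
  have f: "ac_density a f f'"
    unfolding f_def f'_def using ac_density_mult[OF sq Y] by simp
  have f': "ac_density a f' f''"
    unfolding f'_def f''_def
    using ac_density_lincomb[OF ac_density_mult[OF cr Y] ac_density_mult[OF sq V], of 1] by simp
  \<comment> \<open>Up to a + \<epsilon> the truncation at a + \<delta> is inactive and the terms
    with \<open>q\<close> cancel; afterwards \<open>r\<close> is zero.\<close>
  have H: "- f'' x + of_real (q x) * f x = H x" for x
    using r0[of x] \<epsilon> by (auto simp: f''_def f_def H_def algebra_simps)
  have meas: "g \<in> borel_measurable (lebesgue_on {a..})"
    if "continuous_on {a..} g" for g :: "real \<Rightarrow> complex"
    using that by (simp add: continuous_imp_measurable_on_sets_lebesgue)
  have mr': "r' \<in> borel_measurable (lebesgue_on {a..})"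
    unfolding r'_def by (intro measurable_restrict_space1 measurable_completion) measurable
  note [measurable] = mr' meas[OF ac_density_continuous[OF r]] meas[OF ac_density_continuous[OF Y]]
    meas[OF ac_density_continuous[OF V]]
  have A: "A \<ge> 0" and B: "B \<ge> 0"
    using order_trans[OF norm_ge_zero bY[of a]] order_trans[OF norm_ge_zero bV[of a]] \<epsilon> by auto
  have bf: "cmod (f x) \<le> A * indicator {a..a+\<epsilon>} x" if "x \<ge> a" for x
  proof (cases "x \<le> a + \<epsilon>")
    case True
    have "cmod (f x) \<le> 1 * 1 * A"
      unfolding f_def norm_mult using r1[OF that] bY[of x] True that
      by (intro mult_mono) auto
    then show ?thesis using True that by simp
  qed (use r0[of x] in \<open>simp add: f_def\<close>)
  have bH: "cmod (H x) \<le> (2 / \<epsilon>\<^sup>2 * A + 4 / \<epsilon> * B) * indicator {a..a+\<epsilon>} x" if "x \<ge> a" for x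
  proof (cases "x \<le> a + \<epsilon>")
    case True
    have "cmod (H x) \<le> cmod c * cmod (r' x) * cmod (Y x) + 2 * cmod c * cmod (r x) * cmod (V x)"
      unfolding H_def norm_minus_cancel by (rule order_trans[OF norm_triangle_ineq]) (simp add: norm_mult)
    also have "\<dots> \<le> cmod c * (1 / \<epsilon>) * A + 2 * cmod c * 1 * B"
      using r1[OF that] bY[of x] bV[of x] True that \<epsilon> A B
      by (intro add_mono mult_mono mult_nonneg_nonneg) (auto simp: r'_def norm_divide)
    also have "\<dots> = 2 / \<epsilon>\<^sup>2 * A + 4 / \<epsilon> * B"
      using \<epsilon> by (simp add: c_def norm_divide power2_eq_square)
    finally show ?thesis using True that by simp
  qed (use r0[of x] r'0[of x] in \<open>simp add: H_def\<close>)
  have fL: "f \<in> L2 a"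
    by (rule L2_bounded_support[OF _ bf]) (use meas ac_density_continuous[OF f] in auto)
  have HL: "H \<in> L2 a"
  proof (rule L2_bounded_support[OF _ bH])
    show "H \<in> borel_measurable (lebesgue_on {a..})"
      unfolding H_def by measurable
  qed
  note I = H_plusI[OF f f' fL, of q, unfolded H, OF HL]
  have ra: "r a = 1" by (simp add: r_def)
  show thesis
  proof (rule that[of f H])
    show "f a = Y a" by (simp add: f_def ra)
    show "D1 a f a = V a - 2 / of_real \<epsilon> * Y a"
      using I(2)[of a] by (simp add: f'_def ra c_def)
    show "f x = 0 \<and> D1 a f x = 0" if "x \<ge> a + \<epsilon>" for x
      using I(2)[of x] r0[OF that] that \<epsilon> by (simp add: f_def f'_def)
  qed (use I bf bH HL in auto)
qed

text \<open>
  Cutting off the solution with data \<open>(0, 1)\<close> at \<open>a + \<epsilon>\<close> gives a function of size \<open>O(\<epsilon>)\<close> whose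
  image under the differential expression has size \<open>O(1/\<epsilon>)\<close>, both on an interval of length \<open>\<epsilon>\<close>.
\<close>

lemma boundary_spike_exists:
  assumes q: "locally_summable a q" and g: "g \<in> L2 a" and \<eta>: "\<eta> > 0"
  obtains f b where "f \<in> H_plus a q" "f a = 0" "D1 a f a = 1"
    "\<And>x. x \<ge> b \<Longrightarrow> f x = 0 \<and> D1 a f x = 0"
    "cmod (ip a (lexpr a q f) f) < \<eta>" "cmod (ip a g f) < \<eta>"
proof -
  obtain \<delta> Y V where \<delta>: "\<delta> > 0" and YV: "Y a = 0" "V a = 1" and Y: "ac_density a Y V"
    and V: "ac_density a V (\<lambda>x. if x \<le> a + \<delta> then of_real (q x) * Y x else 0)"
    using local_solution_exists[OF q] by metis
  have "bounded (V ` {a..a+\<delta>})"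
    by (intro compact_imp_bounded compact_continuous_image
        continuous_on_subset[OF ac_density_continuous[OF V]]) auto
  then obtain C where C: "C > 0" "\<And>x. x \<in> {a..a+\<delta>} \<Longrightarrow> cmod (V x) \<le> C"
    by (auto simp: bounded_pos)
  define N where "N = (LINT x|lebesgue_on {a..}. (cmod (g x))\<^sup>2)"
  have N: "N \<ge> 0" unfolding N_def by simp
  \<comment> \<open>Both inner products will be bounded by \<epsilon> * d: the first by 6 C^2
    \<epsilon>, the second by C (N + \<epsilon>) \<epsilon>.\<close>
  define d where "d = 6 * C\<^sup>2 + C * (N + \<delta>) + 1"
  have d: "d > 0" using C N \<delta> by (simp add: d_def add_nonneg_pos)
  define \<epsilon> where "\<epsilon> = min \<delta> (\<eta> / (2 * d))"
  have \<epsilon>: "0 < \<epsilon>" "\<epsilon> \<le> \<delta>" using \<delta> \<eta> d by (auto simp: \<epsilon>_def)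
  have "\<epsilon> * d \<le> \<eta> / (2 * d) * d"
    using d by (intro mult_right_mono) (auto simp: \<epsilon>_def)
  also have "\<dots> < \<eta>" using d \<eta> by simp
  finally have \<epsilon>d: "\<epsilon> * d < \<eta>" .
  have bV: "cmod (V x) \<le> C" if "x \<in> {a..a+\<epsilon>}" for x
    using C(2) that \<epsilon> by auto
  \<comment> \<open>As \<open>Y\<close> vanishes at a and its derivative \<open>V\<close> is at most
    \<open>C\<close>, it is of order \<epsilon> on the short interval.\<close>
  have bY: "cmod (Y x) \<le> C * \<epsilon>" if x: "x \<in> {a..a+\<epsilon>}" for x
  proof -
    have hi: "(V has_integral Y x - Y a) {a..x}"
      using x by (intro ac_density_has_integral[OF Y]) auto
    have "cmod (Y x - Y a) \<le> C * Henstock_Kurzweil_Integration.content {a..x}"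
      using has_integral_bound_real[OF _ _ hi, of C "{}"] C(1) bV x by auto
    also have "\<dots> \<le> C * \<epsilon>"
      using x C(1) by (intro mult_left_mono) auto
    finally show ?thesis by (simp add: YV)
  qed
  obtain f H where f: "f \<in> H_plus a q" "f a = Y a" "D1 a f a = V a - 2 / of_real \<epsilon> * Y a"
    and supp: "\<And>x. x \<ge> a + \<epsilon> \<Longrightarrow> f x = 0 \<and> D1 a f x = 0"
    and bf: "\<And>x. x \<ge> a \<Longrightarrow> cmod (f x) \<le> C * \<epsilon> * indicator {a..a+\<epsilon>} x"
    and H: "H \<in> L2 a" "eq_ae a H (lexpr a q f)"
    and bH: "\<And>x. x \<ge> a \<Longrightarrow> cmod (H x) \<le> (2 / \<epsilon>\<^sup>2 * (C * \<epsilon>) + 4 / \<epsilon> * C) * indicator {a..a+\<epsilon>} x"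
    using cutoff_in_H_plus[OF Y V \<epsilon> bY bV] by metis
  \<comment> \<open>The orders 1/\<epsilon> of \<open>H\<close> and \<epsilon> of \<open>f\<close>
    compensate, so smallness comes from the length of the interval alone.\<close>
  have coef: "(2 / \<epsilon>\<^sup>2 * (C * \<epsilon>) + 4 / \<epsilon> * C) * (C * \<epsilon>) = 6 * C\<^sup>2"
    using \<epsilon> by (simp add: field_simps power2_eq_square)
  have "cmod (ip a H f) \<le> 0 * (LINT x|lebesgue_on {a..}. (cmod (f x))\<^sup>2) + 6 * C\<^sup>2 * (a + \<epsilon> - a)"
  proof (rule norm_ip_le[OF H(1) H_plusD(1)[OF f(1)] H_plusD(1)[OF f(1)]])
    fix x assume x: "a \<le> x"
    have "cmod (H x) * cmod (f x) \<le> ((2 / \<epsilon>\<^sup>2 * (C * \<epsilon>) + 4 / \<epsilon> * C) * indicator {a..a+\<epsilon>} x)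
        * (C * \<epsilon> * indicator {a..a+\<epsilon>} x)"
      using bf[OF x] bH[OF x] by (intro mult_mono) (auto intro: order_trans[OF norm_ge_zero])
    also have "\<dots> = 6 * C\<^sup>2 * indicator {a..a+\<epsilon>} x"
      unfolding coef[symmetric] by (simp add: indicator_def)
    finally show "cmod (H x) * cmod (f x)
        \<le> 0 * (cmod (f x))\<^sup>2 + 6 * C\<^sup>2 * indicator {a..a+\<epsilon>} x" by simp
  qed (use \<epsilon> in auto)
  also have "\<dots> \<le> \<epsilon> * d"
    using \<epsilon> C N \<delta> by (simp add: d_def mult.commute mult_left_mono)
  finally have 1: "cmod (ip a (lexpr a q f) f) < \<eta>"
    using \<epsilon>d ip_cong_left[OF H(1) H_plusD(1)[OF f(1)] H(2)] by simp
  have "cmod (ip a g f) \<le> C * \<epsilon> * N + C * \<epsilon> * (a + \<epsilon> - a)"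
    unfolding N_def
  proof (rule norm_ip_le[OF g H_plusD(1)[OF f(1)] g])
    fix x assume x: "a \<le> x"
    \<comment> \<open>This elementary bound passes from |g| to its square, whose integral is
      \<open>N\<close>, in place of the Cauchy-Schwarz inequality.\<close>
    have u: "t \<le> t\<^sup>2 + 1" for t :: real
      using zero_le_power2[of "t - 1 / 2"] by (simp add: power2_eq_square algebra_simps)
    have "cmod (g x) * cmod (f x) \<le> cmod (g x) * (C * \<epsilon> * indicator {a..a+\<epsilon>} x)"
      using bf[OF x] by (intro mult_left_mono) auto
    also have "\<dots> \<le> ((cmod (g x))\<^sup>2 + 1) * (C * \<epsilon> * indicator {a..a+\<epsilon>} x)"
      using C \<epsilon> by (intro mult_right_mono u) auto
    also have "\<dots> \<le> C * \<epsilon> * (cmod (g x))\<^sup>2 + C * \<epsilon> * indicator {a..a+\<epsilon>} x"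
      using C \<epsilon> by (auto simp: indicator_def algebra_simps)
    finally show "cmod (g x) * cmod (f x)
        \<le> C * \<epsilon> * (cmod (g x))\<^sup>2 + C * \<epsilon> * indicator {a..a+\<epsilon>} x" .
  qed (use \<epsilon> in auto)
  also have "\<dots> = \<epsilon> * (C * (N + \<epsilon>))" by (simp add: algebra_simps)
  also have "\<dots> \<le> \<epsilon> * d"
  proof (rule mult_left_mono)
    have "C * (N + \<epsilon>) \<le> C * (N + \<delta>)" using C \<epsilon> by (intro mult_left_mono) auto
    then show "C * (N + \<epsilon>) \<le> d" using zero_le_power2[of C] unfolding d_def by linarith
  qed (use \<epsilon> in auto)
  finally have 2: "cmod (ip a g f) < \<eta>" using \<epsilon>d by simp
  show thesis
    by (rule that[OF f(1) _ _ supp 1 2]) (use f YV in auto)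
qed

text \<open>Only the boundary value and the support matter here, so a solution with value 1 at a is
  cut off over the full length \<delta>, with no smallness required.\<close>

lemma H_plus_compact_support_exists:
  assumes q: "locally_summable a q"
  obtains f b where "f \<in> H_plus a q" "f a = 1" "\<And>x. x \<ge> b \<Longrightarrow> f x = 0 \<and> D1 a f x = 0"
proof -
  obtain \<delta> Y V where \<delta>: "\<delta> > 0" and Ya: "Y a = 1" and Y: "ac_density a Y V"
    and V: "ac_density a V (\<lambda>x. if x \<le> a + \<delta> then of_real (q x) * Y x else 0)"
    using local_solution_exists[OF q] by metis
  have "bounded (V ` {a..a+\<delta>})" "bounded (Y ` {a..a+\<delta>})"
    by (intro compact_imp_bounded compact_continuous_image continuous_on_subset[OF ac_density_continuous[OF V]]
        continuous_on_subset[OF ac_density_continuous[OF Y]]; simp)+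
  then obtain A B where "\<And>x. x \<in> {a..a+\<delta>} \<Longrightarrow> cmod (Y x) \<le> A" "\<And>x. x \<in> {a..a+\<delta>} \<Longrightarrow> cmod (V x) \<le> B"
    by (auto simp: bounded_iff simp del: atLeastAtMost_iff)
  then obtain f where "f \<in> H_plus a q" "f a = Y a" "\<And>x. x \<ge> a + \<delta> \<Longrightarrow> f x = 0 \<and> D1 a f x = 0"
    using cutoff_in_H_plus[OF Y V \<delta> order_refl, of A B] by metis
  with Ya that show thesis by metis
qed

subsection \<open>The energy form and the associated operator\<close>

text \<open>
  The boundary term is removed so that, formally, this is \<open>\<integral> |y'|\<^sup>2 + q |y|\<^sup>2\<close>, in which the value
  \<open>y'(a)\<close> no longer plays a role.
\<close>

definition energy_form :: "real \<Rightarrow> (real \<Rightarrow> real) \<Rightarrow> (real \<Rightarrow> complex) \<Rightarrow> real" where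
  "energy_form a q y = Re (ip a (lexpr a q y) y) - Re (D1 a y a * cnj (y a))"

lemma ip_lexpr_lincomb:
  assumes y: "y \<in> H_plus a q" and z: "z \<in> H_plus a q"
  shows "ip a (lexpr a q (\<lambda>x. y x + c * z x)) (\<lambda>x. y x + c * z x) =
    ip a (lexpr a q y) y + cnj c * ip a (lexpr a q y) z
    + c * ip a (lexpr a q z) y + c * cnj c * ip a (lexpr a q z) z"
proof -
  note Y = H_plusD[OF y] and Z = H_plusD[OF z] and S = H_plus_lincomb[OF y z, where c = c]
  \<comment> \<open>The expression \<open>lexpr\<close> is linear only almost everywhere, because of
    the choice inside \<open>D2\<close>.\<close>
  have "ip a (lexpr a q (\<lambda>x. y x + c * z x)) (\<lambda>x. y x + c * z x) =
      ip a (\<lambda>x. lexpr a q y x + c * lexpr a q z x) (\<lambda>x. y x + c * z x)"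
    by (rule ip_cong_left[OF L2_lincomb[OF Y(2) Z(2)] H_plusD(1)[OF S(1)] S(3)])
  then show ?thesis
    by (simp add: ip_lincomb_left[OF Y(2) Z(2) H_plusD(1)[OF S(1)]]
        ip_lincomb_right[OF Y(1) Z(1) Y(2)] ip_lincomb_right[OF Y(1) Z(1) Z(2)] algebra_simps)
qed

text \<open>A multiple \<open>t\<close> of a spike with boundary data (0, 1) is added. By Green's
  formula the cross terms leave the boundary contribution t * cnj (y a), exactly cancelled by the
  boundary term subtracted in \<open>energy_form\<close>; everything else is controlled by the small
  inner products.\<close>

lemma energy_form_perturb:
  assumes q: "locally_summable a q" and y: "y \<in> H_plus a q" and \<eta>: "\<eta> > 0"
  obtains z where "z \<in> H_plus a q" "z a = y a" "D1 a z a = D1 a y a + t"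
    "energy_form a q z < energy_form a q y + \<eta>"
proof -
  \<comment> \<open>The coefficients of the two cross terms and of the quadratic term; the added 1
    makes the final inequality strict even for \<open>t = 0\<close>.\<close>
  define K where "K = 2 * cmod t + (cmod t)\<^sup>2 + 1"
  have K: "K > 0" by (simp add: K_def add_nonneg_pos)
  define e where "e = \<eta> / K"
  have e: "e > 0" "K * e = \<eta>" using K \<eta> by (auto simp: e_def)
  obtain f b where f: "f \<in> H_plus a q" "f a = 0" "D1 a f a = 1"
    and supp: "\<And>x. x \<ge> b \<Longrightarrow> f x = 0 \<and> D1 a f x = 0"
    and small: "cmod (ip a (lexpr a q f) f) < e" "cmod (ip a (lexpr a q y) f) < e"
    using boundary_spike_exists[OF q H_plusD(2)[OF y], of e] e(1) by auto
  define p where "p = ip a (lexpr a q y) f"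
  define s where "s = ip a (lexpr a q f) f"
  define z where "z = (\<lambda>x. y x + t * f x)"
  have "ip a (lexpr a q f) y - cnj p = cnj (y a)"
    using green_formula[OF y f(1) supp] f ip_commute[of a f "lexpr a q y"] by (simp add: p_def)
  then have g: "ip a (lexpr a q f) y = cnj p + cnj (y a)"
    by (simp add: algebra_simps)
  have Dz: "D1 a z a = D1 a y a + t"
    using H_plus_lincomb(2)[OF y f(1) order_refl, where c = t] f by (simp add: z_def)
  have "energy_form a q z = energy_form a q y + (Re (cnj t * p) + Re (t * cnj p) + Re (t * cnj t * s))"
    unfolding energy_form_def Dz unfolding z_def ip_lexpr_lincomb[OF y f(1)] g
    by (simp add: f p_def s_def algebra_simps)
  also have "Re (cnj t * p) + Re (t * cnj p) + Re (t * cnj t * s)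
      \<le> cmod (cnj t * p) + cmod (t * cnj p) + cmod (t * cnj t * s)"
    by (intro add_mono complex_Re_le_cmod)
  also have "\<dots> = 2 * cmod t * cmod p + (cmod t)\<^sup>2 * cmod s"
    by (simp add: norm_mult power2_eq_square)
  also have "\<dots> \<le> 2 * cmod t * e + (cmod t)\<^sup>2 * e"
    using small by (intro add_mono mult_left_mono) (auto simp: p_def s_def)
  also have "\<dots> < K * e"
    using e(1) by (simp add: K_def distrib_right)
  also note e(2)
  finally have "energy_form a q z < energy_form a q y + \<eta>" by simp
  then show thesis
    by (intro that[OF _ _ Dz]) (use H_plus_lincomb(1)[OF y f(1)] f in \<open>auto simp: z_def\<close>)
qed

text \<open>
  Subtracting a compactly supported function with the same boundary data leaves an element of the
  domain of the minimal operator, so the limit-point property at infinity is replaced by symmetry.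
\<close>

lemma Im_ip_lexpr:
  assumes q: "locally_summable a q" and sym: "symmetric_operator a (Dom_min a q) (lexpr a q)"
    and y: "y \<in> H_plus a q"
  shows "Im (ip a (lexpr a q y) y) = Im (D1 a y a * cnj (y a))"
proof -
  obtain f1 b1 where f1: "f1 \<in> H_plus a q" "f1 a = 1"
    and s1: "\<And>x. x \<ge> b1 \<Longrightarrow> f1 x = 0 \<and> D1 a f1 x = 0"
    using H_plus_compact_support_exists[OF q] by metis
  obtain f2 b2 where f2: "f2 \<in> H_plus a q" "f2 a = 0" "D1 a f2 a = 1"
    and s2: "\<And>x. x \<ge> b2 \<Longrightarrow> f2 x = 0 \<and> D1 a f2 x = 0"
    using boundary_spike_exists[OF q H_plusD(2)[OF y] zero_less_one] by metis
  \<comment> \<open>The coefficient of \<open>f2\<close> corrects the uncontrolled derivative at a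
    of \<open>f1\<close>, so that \<open>f\<close> has the same boundary data as
    \<open>y\<close>.\<close>
  define c where "c = D1 a y a - y a * D1 a f1 a"
  define g where "g = (\<lambda>x. 0 + y a * f1 x)"
  define f where "f = (\<lambda>x. g x + c * f2 x)"
  have g: "g \<in> H_plus a q" "\<And>x. x \<ge> a \<Longrightarrow> D1 a g x = D1 a (\<lambda>_. 0) x + y a * D1 a f1 x"
    unfolding g_def by (rule H_plus_lincomb[OF zero_H_plus(1) f1(1)])+
  have D0: "D1 a (\<lambda>_. 0) x = 0" if "x \<ge> a" for x
    by (rule D1_eq[OF has_vector_derivative_const that])
  have f: "f \<in> H_plus a q" "\<And>x. x \<ge> a \<Longrightarrow> D1 a f x = D1 a g x + c * D1 a f2 x"
    unfolding f_def by (rule H_plus_lincomb[OF g(1) f2(1)])+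
  have fa: "f a = y a" "D1 a f a = D1 a y a"
    using f(2)[of a] g(2)[of a] D0 by (simp_all add: f_def g_def f1 f2 c_def)
  define b where "b = max a (max b1 b2)"
  have supp: "f x = 0 \<and> D1 a f x = 0" if "x \<ge> b" for x
    using f(2)[of x] g(2)[of x] D0[of x] s1[of x] s2[of x] that by (simp add: b_def f_def g_def)
  define z where "z = (\<lambda>x. y x + (-1) * f x)"
  have z: "z \<in> H_plus a q" "D1 a z a = 0" "z a = 0"
    using H_plus_lincomb(1)[OF y f(1), where c = "-1"]
      H_plus_lincomb(2)[OF y f(1) order_refl, where c = "-1"] fa by (simp_all add: z_def)
  have "z \<in> Dom_min a q"
    using z by (simp add: Dom_min_def)
  then have zz: "ip a (lexpr a q z) z = cnj (ip a (lexpr a q z) z)"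
    using sym ip_commute[of a z "lexpr a q z"] by (simp add: symmetric_operator_def)
  have zf: "ip a (lexpr a q f) z = cnj (ip a (lexpr a q z) f)"
    using green_formula[OF z(1) f(1) supp] z ip_commute[of a f "lexpr a q z"] by simp
  have ff: "ip a (lexpr a q f) f - cnj (ip a (lexpr a q f) f) =
      D1 a y a * cnj (y a) - y a * cnj (D1 a y a)"
    using green_formula[OF f(1) f(1) supp] fa ip_commute[of a f "lexpr a q f"] by simp
  have "y = (\<lambda>x. z x + 1 * f x)" by (simp add: z_def)
  \<comment> \<open>The \<open>z\<close> term is real by symmetry, the cross terms are conjugate to
    each other, and the \<open>f\<close> term carries the whole boundary contribution.\<close>
  then have "ip a (lexpr a q y) y = ip a (lexpr a q z) z + ip a (lexpr a q z) f
      + cnj (ip a (lexpr a q z) f) + ip a (lexpr a q f) f"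
    using ip_lexpr_lincomb[OF z(1) f(1), where c = 1] by (simp add: zf)
  moreover have "Im (ip a (lexpr a q z) z) = 0"
    using arg_cong[OF zz, of Im] by simp
  moreover have "Im (ip a (lexpr a q f) f) = Im (D1 a y a * cnj (y a))"
    using arg_cong[OF ff, of Im] by (simp add: algebra_simps)
  ultimately show ?thesis by simp
qed

text \<open>Doubling the real part of the maximal operator turns \<open>L\<close> into
  \<open>cnj L\<close>. The rank-one boundary term is expanded through
  \<open>v - h u = w + k u\<close>, where the factor \<open>k\<close> cancels the denominator and
  separates the part in |w|^2.\<close>

lemma associated_op_finite:
  fixes m :: real
  assumes "Im h \<noteq> 0"
  shows "Re (associated_op a q (A_mu a q h (ereal m)) y y) = energy_form a q y + m * (cmod (y a))\<^sup>2
      + (Re h - m) * (cmod (D1 a y a - of_real m * y a))\<^sup>2 / (cmod (of_real m - h))\<^sup>2" (is ?R)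
    and "Im (associated_op a q (A_mu a q h (ereal m)) y y) =
      Im (D1 a y a * cnj (y a)) - Im (ip a (lexpr a q y) y)
      - Im h * (cmod (D1 a y a - of_real m * y a))\<^sup>2 / (cmod (of_real m - h))\<^sup>2" (is ?I)
proof -
  define L where "L = ip a (lexpr a q y) y"
  define u where "u = y a"
  define v where "v = D1 a y a"
  define k where "k = of_real m - h"
  define w where "w = v - of_real m * u"
  have k: "k \<noteq> 0"
    using assms by (auto simp: k_def complex_eq_iff)
  have k2: "1 / k = cnj k / of_real ((cmod k)\<^sup>2)"
    using k by (simp add: field_simps complex_norm_square del: of_real_power)
  have "associated_op a q (A_mu a q h (ereal m)) y y =
      2 * ((L + cnj L) / 2) - (L - 1 / k * (v - h * u) * (of_real m * cnj u + - cnj v))"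
    by (simp add: associated_op_def Re_op_def adj_op_def A_max_def A_mu_def embed_def delta_def
        delta'_def L_def u_def v_def k_def Let_def)
  also have "\<dots> = cnj L + 1 / k * (v - h * u) * (of_real m * cnj u - cnj v)"
    by (simp add: add_divide_distrib)
  also have "v - h * u = w + k * u"
    by (simp add: w_def k_def algebra_simps)
  also have "of_real m * cnj u - cnj v = - cnj w"
    by (simp add: w_def)
  also have "1 / k * (w + k * u) * - cnj w = - (w * cnj w) * (1 / k) - u * cnj w"
    using k by (simp add: field_simps)
  also have "w * cnj w = of_real ((cmod w)\<^sup>2)"
    by (rule complex_norm_square[symmetric])
  also have "u * cnj w = u * cnj v - of_real m * of_real ((cmod u)\<^sup>2)"
    unfolding complex_norm_square by (simp add: w_def algebra_simps)
  finally have A: "associated_op a q (A_mu a q h (ereal m)) y y =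
      cnj L + (- of_real ((cmod w)\<^sup>2) * (cnj k / of_real ((cmod k)\<^sup>2))
        - (u * cnj v - of_real m * of_real ((cmod u)\<^sup>2)))"
    unfolding k2 .
  have ReIm: "Re (- of_real ((cmod w)\<^sup>2) * (cnj k / of_real ((cmod k)\<^sup>2))) = (Re h - m) * (cmod w)\<^sup>2 / (cmod k)\<^sup>2"
    "Im (- of_real ((cmod w)\<^sup>2) * (cnj k / of_real ((cmod k)\<^sup>2))) = - Im h * (cmod w)\<^sup>2 / (cmod k)\<^sup>2"
    by (simp_all add: Re_divide_of_real Im_divide_of_real k_def algebra_simps diff_divide_distrib del: of_real_power)
  have uv: "Re (u * cnj v) = Re (v * cnj u)" "Im (u * cnj v) = - Im (v * cnj u)"
    by (simp_all add: algebra_simps)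
  show ?R
    unfolding A plus_complex.sel minus_complex.sel ReIm uv
    by (simp add: energy_form_def L_def u_def v_def w_def k_def del: of_real_power)
  show ?I
    unfolding A plus_complex.sel minus_complex.sel ReIm uv
    by (simp add: L_def u_def v_def w_def k_def del: of_real_power)
qed

text \<open>Here the boundary derivative enters linearly apart from the energy, so the form can be
  driven below zero by varying it.\<close>

lemma associated_op_infinite:
  assumes "\<bar>\<mu>\<bar> = \<infinity>"
  shows "Re (associated_op a q (A_mu a q h \<mu>) y y) = energy_form a q y
      + 2 * Re (D1 a y a * cnj (y a)) - Re h * (cmod (y a))\<^sup>2"
proof -
  have "Re (h * y a * cnj (y a)) = Re h * (cmod (y a))\<^sup>2"
    by (simp add: mult.assoc flip: complex_norm_square)
  then show ?thesis
    using assms by (simp add: associated_op_def Re_op_def adj_op_def A_max_def A_mu_def embed_def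
        delta_def energy_form_def algebra_simps)
qed

section \<open>Characterization of the critical boundary parameter\<close>

theorem theorem7:
  fixes a :: real and q :: "real \<Rightarrow> real" and h :: complex
    and \<alpha> :: real and \<mu> :: ereal and \<Theta> :: L_system
  assumes "locally_summable a q"
    and "densely_defined a (Dom_min a q)"
    and "closed_operator a (Dom_min a q) (lexpr a q)"
    and "symmetric_operator a (Dom_min a q) (lexpr a q)"
    and "deficiency_indices_1_1 a (Dom_min a q) (lexpr a q)"
    and "nonnegative_operator a (Dom_min a q) (lexpr a q)"
    and "m_infinity_finite_at_0_left a q"
    and "Im h > 0"
    and "0 < \<alpha>" and "\<alpha> < pi / 2"
    and "sectorial a (Dom_T a q h) (lexpr a q) \<alpha>"
    and "exact_angle a (Dom_T a q h) (lexpr a q) \<alpha>"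
    and "is_L_system a q h \<Theta>"
    and "state_op \<Theta> = A_mu a q h \<mu>"
  shows "(accretive_rigged a q (associated_op a q (state_op \<Theta>)) \<and>
          \<not> (\<exists>\<alpha>'. 0 < \<alpha>' \<and> \<alpha>' < pi / 2 \<and>
               sectorial_rigged a q (associated_op a q (state_op \<Theta>)) \<alpha>'))
         \<longleftrightarrow> \<mu> = ereal (Re h)"
proof -
  let ?B = "associated_op a q (A_mu a q h \<mu>)"
  note q = assms(1)
  have h: "Im h > 0" "Im h \<noteq> 0" using assms(8) by auto
  note Re_fin = associated_op_finite(1)[OF h(2), of a q]
  have Im_fin: "Im (associated_op a q (A_mu a q h (ereal m)) y y) =
      - Im h * (cmod (D1 a y a - of_real m * y a))\<^sup>2 / (cmod (of_real m - h))\<^sup>2"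
    if "y \<in> H_plus a q" for m y
    using associated_op_finite(2)[OF h(2)] Im_ip_lexpr[OF q assms(4) that] by simp
  have n: "(cmod (of_real m - h))\<^sup>2 > 0" for m
    using h by (auto simp: complex_eq_iff)
  \<comment> \<open>Spikes obtained by perturbing the zero function: fixed boundary data (0, 1),
    hence w = 1, with energy below any prescribed positive bound.\<close>
  obtain s where s: "\<And>\<eta>. \<eta> > 0 \<Longrightarrow> s \<eta> \<in> H_plus a q \<and> s \<eta> a = 0 \<and> D1 a (s \<eta>) a = 1
      \<and> energy_form a q (s \<eta>) < \<eta>"
  proof -
    have "\<exists>z. z \<in> H_plus a q \<and> z a = 0 \<and> D1 a z a = 1 \<and> energy_form a q z < \<eta>" if "\<eta> > 0" for \<eta>
    proof -
      have "energy_form a q (\<lambda>_. 0) = 0"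
        by (simp add: energy_form_def ip_def)
      then show ?thesis
        using energy_form_perturb[OF q zero_H_plus(1) that, of 1] zero_H_plus(2)[of a] by fastforce
    qed
    then show thesis using that by metis
  qed
  \<comment> \<open>Adjusting the boundary derivative to k * y a costs arbitrarily little energy, so
    nonnegativity under this boundary condition spreads to all of \<open>H_plus\<close>. It is
    applied with k = m, where w vanishes, and with k = h, the domain of the main operator.\<close>
  have bdd_below: "energy_form a q y + c * (cmod (y a))\<^sup>2 \<ge> 0"
    if y: "y \<in> H_plus a q"
      and pos: "\<And>z. z \<in> H_plus a q \<Longrightarrow> D1 a z a = k * z a \<Longrightarrow> energy_form a q z + c * (cmod (z a))\<^sup>2 \<ge> 0"
    for c k y
  proof (rule field_le_epsilon)
    fix e :: real assume "e > 0"
    then obtain z where z: "z \<in> H_plus a q" "z a = y a" "D1 a z a = D1 a y a + (k * y a - D1 a y a)"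
      "energy_form a q z < energy_form a q y + e"
      using energy_form_perturb[OF q y] by metis
    then show "0 \<le> energy_form a q y + c * (cmod (y a))\<^sup>2 + e"
      using pos[OF z(1)] by simp
  qed
  show ?thesis
    unfolding assms(14)
  proof
    assume *: "accretive_rigged a q ?B \<and> \<not> (\<exists>\<alpha>'. 0 < \<alpha>' \<and> \<alpha>' < pi / 2 \<and> sectorial_rigged a q ?B \<alpha>')"
    then have acc: "Re (?B y y) \<ge> 0" if "y \<in> H_plus a q" for y
      using that by (simp add: accretive_rigged_def)
    have "\<bar>\<mu>\<bar> \<noteq> \<infinity>"
    proof
      assume inf: "\<bar>\<mu>\<bar> = \<infinity>"
      obtain y where y: "y \<in> H_plus a q" "y a = 1"
        using H_plus_compact_support_exists[OF q] by metis
      \<comment> \<open>With boundary value 1 and boundary derivative \<open>r\<close> the real part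
        is at most E(y) + 1 + 2 r - Re h, where E(y) is the energy of \<open>y\<close>; this choice
        makes that bound -2.\<close>
      define r where "r = (Re h - 1 - energy_form a q y) / 2 - 1"
      obtain z where z: "z \<in> H_plus a q" "z a = y a" "D1 a z a = D1 a y a + (of_real r - D1 a y a)"
        "energy_form a q z < energy_form a q y + 1"
        using energy_form_perturb[OF q y(1) zero_less_one] by metis
      have "Re (?B z z) = energy_form a q z + 2 * r - Re h"
        using z(2,3) y(2) by (simp add: associated_op_infinite[OF inf])
      also have "\<dots> < 0"
        using z(4) by (simp add: r_def field_simps)
      finally have "Re (?B z z) < 0" .
      with acc[OF z(1)] show False by simp
    qed
    then obtain m where m: "\<mu> = ereal m" by (cases \<mu>) auto
    define N where "N = (cmod (of_real m - h))\<^sup>2"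
    have N: "N > 0" unfolding N_def by (rule n)
    have "\<not> m > Re h"
    proof
      assume gt: "m > Re h"
      \<comment> \<open>The modulus of the negative term in |w|^2 for a spike, which outweighs an
        energy below it.\<close>
      define \<eta> where "\<eta> = (m - Re h) / N"
      have "\<eta> > 0" using gt N by (simp add: \<eta>_def)
      with s[OF this] have "Re (?B (s \<eta>) (s \<eta>)) < 0"
        by (simp add: m Re_fin \<eta>_def N_def[symmetric] diff_divide_distrib)
      with acc s[OF \<open>\<eta> > 0\<close>] show False by fastforce
    qed
    moreover have "\<not> m < Re h"
    proof
      assume lt: "m < Re h"
      \<comment> \<open>For this angle the terms in |w|^2 on the two sides of the sectorial
        inequality coincide, and only the nonnegativity of the remaining form is left to
        check.\<close>
      define \<alpha>' where "\<alpha>' = arctan (Im h / (Re h - m))"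
      have \<alpha>': "0 < \<alpha>'" "\<alpha>' < pi / 2"
        using lt h arctan_ubound by (simp_all add: \<alpha>'_def zero_less_arctan_iff)
      have cot: "cot \<alpha>' * Im h = Re h - m"
        using lt h by (simp add: cot_altdef \<alpha>'_def tan_arctan)
      have "cot \<alpha>' * \<bar>Im (?B y y)\<bar> \<le> Re (?B y y)" if y: "y \<in> H_plus a q" for y
      proof -
        let ?w = "(cmod (D1 a y a - of_real m * y a))\<^sup>2"
        have "energy_form a q y + m * (cmod (y a))\<^sup>2 \<ge> 0"
        proof (rule bdd_below[OF y])
          fix z assume "z \<in> H_plus a q" "D1 a z a = of_real m * z a"
          then show "energy_form a q z + m * (cmod (z a))\<^sup>2 \<ge> 0"
            using acc[of z] by (simp add: m Re_fin)
        qed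
        moreover have "cot \<alpha>' * \<bar>Im (?B y y)\<bar> = (cot \<alpha>' * Im h) * ?w / N"
          using h N by (simp add: m Im_fin[OF y] N_def[symmetric] abs_mult)
        moreover have "Re (?B y y) = energy_form a q y + m * (cmod (y a))\<^sup>2 + (Re h - m) * ?w / N"
          by (simp add: m Re_fin N_def)
        ultimately show ?thesis by (simp add: cot)
      qed
      with \<alpha>' * show False by (auto simp: sectorial_rigged_def)
    qed
    ultimately show "\<mu> = ereal (Re h)" using m by simp
  next
    assume m: "\<mu> = ereal (Re h)"
    have "Re (?B y y) \<ge> 0" if y: "y \<in> H_plus a q" for y
    proof -
      have "energy_form a q y + Re h * (cmod (y a))\<^sup>2 \<ge> 0"
      proof (rule bdd_below[OF y])
        fix z assume z: "z \<in> H_plus a q" "D1 a z a = h * z a"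
        have "0 \<le> cot \<alpha> * \<bar>Im (ip a (lexpr a q z) z)\<bar>"
          using cot_gt_zero[OF assms(9,10)] by simp
        also have "\<dots> \<le> Re (ip a (lexpr a q z) z)"
          using assms(11) z by (simp add: sectorial_def Dom_T_def)
        also have "\<dots> = energy_form a q z + Re h * (cmod (z a))\<^sup>2"
          by (simp add: energy_form_def z(2) mult.assoc flip: complex_norm_square)
        finally show "energy_form a q z + Re h * (cmod (z a))\<^sup>2 \<ge> 0" .
      qed
      then show ?thesis by (simp add: m Re_fin)
    qed
    moreover have "\<not> sectorial_rigged a q ?B \<alpha>'" if "0 < \<alpha>'" "\<alpha>' < pi / 2" for \<alpha>'
    proof
      assume sec: "sectorial_rigged a q ?B \<alpha>'"
      \<comment> \<open>For a spike this equals cot \<alpha>' times the modulus of the imaginary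
        part, while the real part is just its energy, which is smaller.\<close>
      define \<eta> where "\<eta> = cot \<alpha>' * (Im h / (cmod (of_real (Re h) - h))\<^sup>2)"
      have \<eta>: "\<eta> > 0"
        using cot_gt_zero[OF that] h n[of "Re h"] by (simp add: \<eta>_def)
      note z = s[OF \<eta>]
      have "\<bar>Im (?B (s \<eta>) (s \<eta>))\<bar> = Im h / (cmod (of_real (Re h) - h))\<^sup>2"
        using h z by (simp add: m Im_fin)
      moreover have "Re (?B (s \<eta>) (s \<eta>)) = energy_form a q (s \<eta>)"
        using z by (simp add: m Re_fin)
      ultimately have "\<eta> \<le> energy_form a q (s \<eta>)"
        using sec z unfolding sectorial_rigged_def \<eta>_def by metis
      with z show False by simp
    qed
    ultimately show "accretive_rigged a q ?B \<and>
        \<not> (\<exists>\<alpha>'. 0 < \<alpha>' \<and> \<alpha>' < pi / 2 \<and> sectorial_rigged a q ?B \<alpha>')"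
      by (auto simp: accretive_rigged_def)
  qed
qed

end
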